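(* Let $G_7$ be the graph obtained from the complete graph $K_7$ on the vertices $a,b,c,d,e,f,g$ by performing successively the following seven moves: (1) $\nabla\mathrm{Y}$ on the 3-cycle $abc$, with new vertex $h$; (2) $\nabla\mathrm{Y}$ on $ade$, with new vertex $i$; (3) $\nabla\mathrm{Y}$ on $afg$, with new vertex $j$; (4) $\nabla\mathrm{Y}$ on $bdf$, with new vertex $k$; (5) $\nabla\mathrm{Y}$ on $beg$, with new vertex $l$; (6) $\mathrm{Y}\nabla$ at the degree-three vertex $a$, whose neighbors are $h,i,j$, deleting $a$; (7) $\mathrm{Y}\nabla$ at the degree-three vertex $b$, whose neighbors are $h,k,l$, deleting $b$. Then $G_7$ is not intrinsically knotted; that is, there is an embedding of $G_7$ in $\mathbb{R}^3$ none of whose cycles is a nontrivial knot.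
   Context: All graphs are connected, finite and simple (no loops, no double-edges). A graph is intrinsically knotted if every embedding of it in $\mathbb{R}^3$ contains a cycle that is a nontrivial knot. A $\nabla\mathrm{Y}$ move on an abstract graph, on a 3-cycle $xyz$ and with new vertex $v$, consists of removing the three edges $xy$, $yz$, $zx$ and then adding a new vertex $v$ and connecting it by an edge to each of $x$, $y$, $z$. A $\mathrm{Y}\nabla$ move is the reverse: given a vertex $v$ of degree exactly three with neighbors $x,y,z$, delete $v$ (and its three incident edges) and add the edges $xy$, $yz$, $zx$; whenever this introduces a double-edge, one of the two edges is deleted. Explicitly, $G_7$ has the 10 vertices $c,d,e,f,g,h,i,j,k,l$ and the 21 edges $cd, ce, cf, cg, ch, dg, ef, di, ei, fj, gj, dk, fk, el, gl, hi, hj, ij, hk, hl, kl$. *)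

theory Defs
  imports "HOL-Analysis.Analysis"
begin

record 'v ugraph =
  verts :: "'v set"
  edges :: "'v set set"

definition simple_graph :: "'v ugraph \<Rightarrow> bool" where
  "simple_graph G \<longleftrightarrow> finite (verts G) \<and> (\<forall>e\<in>edges G. e \<subseteq> verts G \<and> card e = 2)"

definition complete_graph :: "'v set \<Rightarrow> 'v ugraph" where
  "complete_graph V = \<lparr>verts = V, edges = {e \<in> Pow V. card e = 2}\<rparr>"

definition neighbors :: "'v ugraph \<Rightarrow> 'v \<Rightarrow> 'v set" where
  "neighbors G v = {u \<in> verts G. {v, u} \<in> edges G}"

text \<open>A cycle is given by the list of its successive vertices; the last one is joined to the
  first.\<close>

definition cycle_edges :: "'v list \<Rightarrow> 'v set set" where
  "cycle_edges vs = (\<lambda>(u, w). {u, w}) ` set (zip vs (rotate1 vs))"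

definition is_cycle :: "'v ugraph \<Rightarrow> 'v list \<Rightarrow> bool" where
  "is_cycle G vs \<longleftrightarrow>
     length vs \<ge> 3 \<and> distinct vs \<and> set vs \<subseteq> verts G \<and> cycle_edges vs \<subseteq> edges G"

definition nablaY :: "'v ugraph \<Rightarrow> 'v \<Rightarrow> 'v \<Rightarrow> 'v \<Rightarrow> 'v \<Rightarrow> 'v ugraph" where
  "nablaY G x y z v =
     \<lparr>verts = insert v (verts G),
      edges = (edges G - {{x, y}, {y, z}, {z, x}}) \<union> {{v, x}, {v, y}, {v, z}}\<rparr>"

definition nablaY_move :: "'v ugraph \<Rightarrow> 'v \<Rightarrow> 'v \<Rightarrow> 'v \<Rightarrow> 'v \<Rightarrow> 'v ugraph \<Rightarrow> bool" where
  "nablaY_move G x y z v G' \<longleftrightarrow>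
     is_cycle G [x, y, z] \<and> v \<notin> verts G \<and> G' = nablaY G x y z v"

text \<open>Edges form a set, so a double edge created by the reverse move is merged automatically.\<close>

definition Ynabla :: "'v ugraph \<Rightarrow> 'v \<Rightarrow> 'v \<Rightarrow> 'v \<Rightarrow> 'v \<Rightarrow> 'v ugraph" where
  "Ynabla G v x y z =
     \<lparr>verts = verts G - {v},
      edges = {e \<in> edges G. v \<notin> e} \<union> {{x, y}, {y, z}, {z, x}}\<rparr>"

definition Ynabla_move :: "'v ugraph \<Rightarrow> 'v \<Rightarrow> 'v \<Rightarrow> 'v \<Rightarrow> 'v \<Rightarrow> 'v ugraph \<Rightarrow> bool" where
  "Ynabla_move G v x y z G' \<longleftrightarrow>
     v \<in> verts G \<and> distinct [x, y, z] \<and> neighbors G v = {x, y, z} \<and> G' = Ynabla G v x y z"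

text \<open>An embedding of a finite graph: vertices go to distinct points and each edge to an arc
  joining the images of its ends; arcs meet each other, and meet the vertices, only where the graph
  requires it. No tameness is imposed on the arcs.\<close>

definition spatial_embedding ::
    "'v ugraph \<Rightarrow> ('v \<Rightarrow> real^3) \<Rightarrow> ('v set \<Rightarrow> real \<Rightarrow> real^3) \<Rightarrow> bool" where
  "spatial_embedding G p \<gamma> \<longleftrightarrow>
     inj_on p (verts G) \<and>
     (\<forall>e\<in>edges G. arc (\<gamma> e) \<and> {pathstart (\<gamma> e), pathfinish (\<gamma> e)} = p ` e \<and>
        path_image (\<gamma> e) \<inter> p ` verts G = p ` e) \<and>
     (\<forall>e\<in>edges G. \<forall>e'\<in>edges G. e \<noteq> e' \<longrightarrow>
        path_image (\<gamma> e) \<inter> path_image (\<gamma> e') = p ` (e \<inter> e'))"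

definition cycle_image :: "('v set \<Rightarrow> real \<Rightarrow> real^3) \<Rightarrow> 'v list \<Rightarrow> (real^3) set" where
  "cycle_image \<gamma> vs = (\<Union>e\<in>cycle_edges vs. path_image (\<gamma> e))"

definition knot :: "(real^3) set \<Rightarrow> bool" where
  "knot K \<longleftrightarrow> (\<exists>g. simple_path g \<and> pathfinish g = pathstart g \<and> K = path_image g)"

definition ambient_isotopic :: "(real^3) set \<Rightarrow> (real^3) set \<Rightarrow> bool" where
  "ambient_isotopic K L \<longleftrightarrow>
     (\<exists>h. homotopic_with_canon (\<lambda>f. \<exists>g. homeomorphism UNIV UNIV f g) UNIV UNIV id h \<and> h ` K = L)"

definition standard_circle :: "(real^3) set" where
  "standard_circle = {x. norm x = 1 \<and> x $ 3 = 0}"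

definition nontrivial_knot :: "(real^3) set \<Rightarrow> bool" where
  "nontrivial_knot K \<longleftrightarrow> knot K \<and> \<not> ambient_isotopic K standard_circle"

definition intrinsically_knotted :: "'v ugraph \<Rightarrow> bool" where
  "intrinsically_knotted G \<longleftrightarrow>
     (\<forall>p \<gamma>. spatial_embedding G p \<gamma> \<longrightarrow>
        (\<exists>vs. is_cycle G vs \<and> nontrivial_knot (cycle_image \<gamma> vs)))"

datatype vertex = Va | Vb | Vc | Vd | Ve | Vf | Vg | Vh | Vi | Vj | Vk | Vl

definition K7 :: "vertex ugraph" where
  "K7 = complete_graph {Va, Vb, Vc, Vd, Ve, Vf, Vg}"

definition G7_explicit :: "vertex ugraph" where
  "G7_explicit = \<lparr>verts = {Vc, Vd, Ve, Vf, Vg, Vh, Vi, Vj, Vk, Vl},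
         edges = {{Vc,Vd}, {Vc,Ve}, {Vc,Vf}, {Vc,Vg}, {Vc,Vh}, {Vd,Vg}, {Ve,Vf},
                  {Vd,Vi}, {Ve,Vi}, {Vf,Vj}, {Vg,Vj}, {Vd,Vk}, {Vf,Vk}, {Ve,Vl},
                  {Vg,Vl}, {Vh,Vi}, {Vh,Vj}, {Vi,Vj}, {Vh,Vk}, {Vh,Vl}, {Vk,Vl}}\<rparr>"

text \<open>The seven moves are all legal, and together they produce exactly this graph.\<close>

lemma moves_iff_G7_explicit:
  "(\<exists>G1 G2 G3 G4 G5 G6.
      nablaY_move K7 Va Vb Vc Vh G1 \<and> nablaY_move G1 Va Vd Ve Vi G2 \<and>
      nablaY_move G2 Va Vf Vg Vj G3 \<and> nablaY_move G3 Vb Vd Vf Vk G4 \<and>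
      nablaY_move G4 Vb Ve Vg Vl G5 \<and> Ynabla_move G5 Va Vh Vi Vj G6 \<and>
      Ynabla_move G6 Vb Vh Vk Vl G) \<longleftrightarrow> G = G7_explicit"
proof -
  let ?G0 = "\<lparr>verts = {Va, Vb, Vc, Vd, Ve, Vf, Vg},
     edges = {{Va,Vb}, {Va,Vc}, {Va,Vd}, {Va,Ve}, {Va,Vf}, {Va,Vg}, {Vb,Vc}, {Vb,Vd},
       {Vb,Ve}, {Vb,Vf}, {Vb,Vg}, {Vc,Vd}, {Vc,Ve}, {Vc,Vf}, {Vc,Vg}, {Vd,Ve},
       {Vd,Vf}, {Vd,Vg}, {Ve,Vf}, {Ve,Vg}, {Vf,Vg}}\<rparr>"
  let ?G1 = "\<lparr>verts = {Va, Vb, Vc, Vd, Ve, Vf, Vg, Vh},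
     edges = {{Va,Vd}, {Va,Ve}, {Va,Vf}, {Va,Vg}, {Va,Vh}, {Vb,Vd}, {Vb,Ve}, {Vb,Vf},
       {Vb,Vg}, {Vb,Vh}, {Vc,Vd}, {Vc,Ve}, {Vc,Vf}, {Vc,Vg}, {Vc,Vh}, {Vd,Ve},
       {Vd,Vf}, {Vd,Vg}, {Ve,Vf}, {Ve,Vg}, {Vf,Vg}}\<rparr>"
  let ?G2 = "\<lparr>verts = {Va, Vb, Vc, Vd, Ve, Vf, Vg, Vh, Vi},
     edges = {{Va,Vf}, {Va,Vg}, {Va,Vh}, {Va,Vi}, {Vb,Vd}, {Vb,Ve}, {Vb,Vf}, {Vb,Vg},
       {Vb,Vh}, {Vc,Vd}, {Vc,Ve}, {Vc,Vf}, {Vc,Vg}, {Vc,Vh}, {Vd,Vf}, {Vd,Vg},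
       {Vd,Vi}, {Ve,Vf}, {Ve,Vg}, {Ve,Vi}, {Vf,Vg}}\<rparr>"
  let ?G3 = "\<lparr>verts = {Va, Vb, Vc, Vd, Ve, Vf, Vg, Vh, Vi, Vj},
     edges = {{Va,Vh}, {Va,Vi}, {Va,Vj}, {Vb,Vd}, {Vb,Ve}, {Vb,Vf}, {Vb,Vg}, {Vb,Vh},
       {Vc,Vd}, {Vc,Ve}, {Vc,Vf}, {Vc,Vg}, {Vc,Vh}, {Vd,Vf}, {Vd,Vg}, {Vd,Vi},
       {Ve,Vf}, {Ve,Vg}, {Ve,Vi}, {Vf,Vj}, {Vg,Vj}}\<rparr>"
  let ?G4 = "\<lparr>verts = {Va, Vb, Vc, Vd, Ve, Vf, Vg, Vh, Vi, Vj, Vk},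
     edges = {{Va,Vh}, {Va,Vi}, {Va,Vj}, {Vb,Ve}, {Vb,Vg}, {Vb,Vh}, {Vb,Vk}, {Vc,Vd},
       {Vc,Ve}, {Vc,Vf}, {Vc,Vg}, {Vc,Vh}, {Vd,Vg}, {Vd,Vi}, {Vd,Vk}, {Ve,Vf},
       {Ve,Vg}, {Ve,Vi}, {Vf,Vj}, {Vf,Vk}, {Vg,Vj}}\<rparr>"
  let ?G5 = "\<lparr>verts = {Va, Vb, Vc, Vd, Ve, Vf, Vg, Vh, Vi, Vj, Vk, Vl},
     edges = {{Va,Vh}, {Va,Vi}, {Va,Vj}, {Vb,Vh}, {Vb,Vk}, {Vb,Vl}, {Vc,Vd}, {Vc,Ve},
       {Vc,Vf}, {Vc,Vg}, {Vc,Vh}, {Vd,Vg}, {Vd,Vi}, {Vd,Vk}, {Ve,Vf}, {Ve,Vi},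
       {Ve,Vl}, {Vf,Vj}, {Vf,Vk}, {Vg,Vj}, {Vg,Vl}}\<rparr>"
  let ?G6 = "\<lparr>verts = {Vb, Vc, Vd, Ve, Vf, Vg, Vh, Vi, Vj, Vk, Vl},
     edges = {{Vb,Vh}, {Vb,Vk}, {Vb,Vl}, {Vc,Vd}, {Vc,Ve}, {Vc,Vf}, {Vc,Vg}, {Vc,Vh},
       {Vd,Vg}, {Vd,Vi}, {Vd,Vk}, {Ve,Vf}, {Ve,Vi}, {Ve,Vl}, {Vf,Vj}, {Vf,Vk},
       {Vg,Vj}, {Vg,Vl}, {Vh,Vi}, {Vh,Vj}, {Vi,Vj}}\<rparr>"
  have m0: "K7 = ?G0" by code_simp
  have m1: "nablaY_move ?G0 Va Vb Vc Vh G \<longleftrightarrow> G = ?G1" for G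
  proof -
    have "nablaY ?G0 Va Vb Vc Vh = ?G1" by code_simp
    moreover have "nablaY_move ?G0 Va Vb Vc Vh (nablaY ?G0 Va Vb Vc Vh)" by code_simp
    ultimately show ?thesis unfolding nablaY_move_def by metis
  qed
  have m2: "nablaY_move ?G1 Va Vd Ve Vi G \<longleftrightarrow> G = ?G2" for G
  proof -
    have "nablaY ?G1 Va Vd Ve Vi = ?G2" by code_simp
    moreover have "nablaY_move ?G1 Va Vd Ve Vi (nablaY ?G1 Va Vd Ve Vi)" by code_simp
    ultimately show ?thesis unfolding nablaY_move_def by metis
  qed
  have m3: "nablaY_move ?G2 Va Vf Vg Vj G \<longleftrightarrow> G = ?G3" for G
  proof -
    have "nablaY ?G2 Va Vf Vg Vj = ?G3" by code_simp
    moreover have "nablaY_move ?G2 Va Vf Vg Vj (nablaY ?G2 Va Vf Vg Vj)" by code_simp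
    ultimately show ?thesis unfolding nablaY_move_def by metis
  qed
  have m4: "nablaY_move ?G3 Vb Vd Vf Vk G \<longleftrightarrow> G = ?G4" for G
  proof -
    have "nablaY ?G3 Vb Vd Vf Vk = ?G4" by code_simp
    moreover have "nablaY_move ?G3 Vb Vd Vf Vk (nablaY ?G3 Vb Vd Vf Vk)" by code_simp
    ultimately show ?thesis unfolding nablaY_move_def by metis
  qed
  have m5: "nablaY_move ?G4 Vb Ve Vg Vl G \<longleftrightarrow> G = ?G5" for G
  proof -
    have "nablaY ?G4 Vb Ve Vg Vl = ?G5" by code_simp
    moreover have "nablaY_move ?G4 Vb Ve Vg Vl (nablaY ?G4 Vb Ve Vg Vl)" by code_simp
    ultimately show ?thesis unfolding nablaY_move_def by metis
  qed
  have m6: "Ynabla_move ?G5 Va Vh Vi Vj G \<longleftrightarrow> G = ?G6" for G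
  proof -
    have "Ynabla ?G5 Va Vh Vi Vj = ?G6" by code_simp
    moreover have "Ynabla_move ?G5 Va Vh Vi Vj (Ynabla ?G5 Va Vh Vi Vj)" by code_simp
    ultimately show ?thesis unfolding Ynabla_move_def by metis
  qed
  have m7: "Ynabla_move ?G6 Vb Vh Vk Vl G \<longleftrightarrow> G = G7_explicit" for G
  proof -
    have "Ynabla ?G6 Vb Vh Vk Vl = G7_explicit" by code_simp
    moreover have "Ynabla_move ?G6 Vb Vh Vk Vl (Ynabla ?G6 Vb Vh Vk Vl)" by code_simp
    ultimately show ?thesis unfolding Ynabla_move_def by metis
  qed
  show ?thesis unfolding m0 using m1 m2 m3 m4 m5 m6 m7 by metis
qed

lemma simple_graph_G7_explicit: "simple_graph G7_explicit"
  by (simp add: simple_graph_def G7_explicit_def)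

end

theory Submission
  imports Defs
begin

text \<open>
  The vertices of the graph are placed on the moment curve \<open>t \<mapsto> (t, t\<^sup>2, t\<^sup>3)\<close>, at the parameters
  \<open>0, \<dots>, 9\<close> in a suitable order, and the edges are straight. No plane meets this curve in more than
  three points, so this is an embedding, whatever the order
  (\<open>moment_spatial_embedding\<close>), and the spatial relations between its edges depend on the
  order of the parameters alone: an edge and a triangle without a common vertex are disjoint unless
  their parameters alternate (\<open>not_pierces_imp_disjoint\<close>).

  Every cycle is thus a polygon. If \<open>u, v, w\<close> are consecutive vertices and no other edge of the polygon
  meets the triangle \<open>u v w\<close>, then \<open>v\<close> can be dropped without changing the isotopy type
  (\<open>triangle_move\<close>): an explicit shear, supported in a thin neighbourhood of the triangle, moves the two
  sides \<open>u v\<close> and \<open>v w\<close> onto the third side. By repeated moves of this kind each of the 801 cycles of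
  the graph becomes a triangle. This is a finite and purely combinatorial statement about
  cyclic sequences of small numbers; a greedy strategy succeeds, and it is carried out by evaluation
  (\<open>visit_G7\<close>).

  Triangles are trivial knots (\<open>triangle_moment_unknotted\<close>): vertices can be exchanged one at a time by
  the same move until the triangle is a particular one around the origin of the plane, which is
  deformed radially to the unit circle.
\<close>

section \<open>Ambient isotopies\<close>

lemma ambient_isotopic_trans:
  assumes "ambient_isotopic K L" "ambient_isotopic L M"
  shows "ambient_isotopic K M"
proof -
  let ?P = "\<lambda>f :: real^3 \<Rightarrow> real^3. \<exists>g. homeomorphism UNIV UNIV f g"
  obtain h k where h: "homotopic_with_canon ?P UNIV UNIV id h" "h ` K = L"
    and k: "homotopic_with_canon ?P UNIV UNIV id k" "k ` L = M"
    using assms unfolding ambient_isotopic_def by blast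
  obtain h' where h': "homeomorphism UNIV UNIV h h'"
    using homotopic_with_imp_property[OF h(1)] by blast
  have "homotopic_with_canon ?P UNIV UNIV (id \<circ> h) (k \<circ> h)"
  proof (rule homotopic_with_compose_continuous_right)
    show "homotopic_with_canon (\<lambda>f. ?P (f \<circ> h)) UNIV UNIV id k"
      by (rule homotopic_with_mono[OF k(1)]) (use h' homeomorphism_compose in blast)
    show "continuous_on UNIV h"
      using h' homeomorphism_cont1 by blast
  qed simp
  then have "homotopic_with_canon ?P UNIV UNIV id (k \<circ> h)"
    using h(1) homotopic_with_trans by force
  moreover have "(k \<circ> h) ` K = M"
    using h(2) k(2) by (metis image_comp)
  ultimately show ?thesis
    unfolding ambient_isotopic_def by blast
qed

lemma ambient_isotopic_sym:
  assumes "ambient_isotopic K L"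
  shows "ambient_isotopic L K"
proof -
  let ?P = "\<lambda>f :: real^3 \<Rightarrow> real^3. \<exists>g. homeomorphism UNIV UNIV f g"
  obtain h where h: "homotopic_with_canon ?P UNIV UNIV id h" "h ` K = L"
    using assms unfolding ambient_isotopic_def by blast
  obtain h' where h': "homeomorphism UNIV UNIV h h'"
    using homotopic_with_imp_property[OF h(1)] by blast
  have "homotopic_with_canon ?P UNIV UNIV (id \<circ> h') (h \<circ> h')"
  proof (rule homotopic_with_compose_continuous_right)
    show "homotopic_with_canon (\<lambda>f. ?P (f \<circ> h')) UNIV UNIV id h"
      by (rule homotopic_with_mono[OF h(1)])
        (use h' homeomorphism_compose homeomorphism_symD in blast)
    show "continuous_on UNIV h'"
      using h' homeomorphism_cont2 by blast
  qed simp
  moreover have hh': "h \<circ> h' = id" and h'h: "h' \<circ> h = id"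
    using h' by (auto simp: homeomorphism_def)
  ultimately have "homotopic_with_canon ?P UNIV UNIV id h'"
    using homotopic_with_sym by force
  moreover have "h' ` L = K"
    using h(2) h'h by (metis image_comp image_id id_apply)
  ultimately show ?thesis
    unfolding ambient_isotopic_def by blast
qed

text \<open>Invariance of domain makes every stage of the isotopy a homeomorphism as soon as it is a
  continuous bijection, so inverse maps never have to be written down.\<close>

lemma ambient_isotopicI:
  fixes H :: "real \<times> (real^3) \<Rightarrow> real^3"
  assumes cont: "continuous_on ({0..1} \<times> UNIV) H"
    and H0: "\<And>x. H (0, x) = x"
    and inj: "\<And>t. t \<in> {0..1} \<Longrightarrow> inj (\<lambda>x. H (t, x))"
    and surj: "\<And>t. t \<in> {0..1} \<Longrightarrow> surj (\<lambda>x. H (t, x))"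
    and KL: "(\<lambda>x. H (1, x)) ` K = L"
  shows "ambient_isotopic K L"
  unfolding ambient_isotopic_def
proof (intro exI conjI)
  show "homotopic_with_canon (\<lambda>f. \<exists>g. homeomorphism UNIV UNIV f g) UNIV UNIV id (\<lambda>x. H (1, x))"
    unfolding homotopic_with_def
  proof (intro exI[of _ H] conjI allI ballI)
    show "continuous_map (prod_topology (top_of_set {0..1}) (top_of_set UNIV)) (top_of_set UNIV) H"
      using cont by (simp only: prod_topology_subtopology_eu continuous_map_subtopology_eu) simp
    fix t :: real assume t: "t \<in> {0..1}"
    have "continuous_on UNIV (\<lambda>x. H (t, x))"
      by (rule continuous_on_compose2[OF cont]) (use t in \<open>auto intro!: continuous_intros\<close>)
    then obtain g where "homeomorphism UNIV (range (\<lambda>x. H (t, x))) (\<lambda>x. H (t, x)) g"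
      using invariance_of_domain_homeomorphism[OF open_UNIV _ _ inj[OF t]] by blast
    then show "\<exists>g. homeomorphism UNIV UNIV (\<lambda>x. H (t, x)) g"
      using surj[OF t] by auto
  qed (simp_all add: H0)
qed (fact KL)

text \<open>Every point slides along its own line in direction \<open>e\<close>. A slope of \<open>\<psi>\<close> below 1 keeps the points
  of such a line in order, which gives injectivity; the intermediate value theorem gives
  surjectivity, because far out on the line nothing moves.\<close>

lemma ambient_isotopic_shear:
  fixes \<psi> :: "real^3 \<Rightarrow> real" and e :: "real^3"
  assumes cont: "continuous_on UNIV \<psi>"
    and nonneg: "\<And>p. 0 \<le> \<psi> p"
    and slope: "\<And>p s. 0 \<le> s \<Longrightarrow> \<psi> (p + s *\<^sub>R e) - \<psi> p \<le> c * s" and c: "c < 1"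
    and vanish: "\<And>p. \<exists>b. \<forall>s\<ge>b. \<psi> (p + s *\<^sub>R e) = 0"
  shows "ambient_isotopic K ((\<lambda>p. p - \<psi> p *\<^sub>R e) ` K)"
proof (cases "e = 0")
  case True
  then show ?thesis
    by (intro ambient_isotopicI[of snd]) (auto intro!: continuous_intros)
next
  case e: False
  define H where "H = (\<lambda>(t, p). p - (t * \<psi> p) *\<^sub>R e)"
  show ?thesis
  proof (rule ambient_isotopicI[of H])
    have "continuous_on ({0..1} \<times> UNIV) (\<lambda>q :: real \<times> (real^3). \<psi> (snd q))"
      by (rule continuous_on_compose2[OF cont]) (auto intro: continuous_intros)
    then show "continuous_on ({0..1} \<times> UNIV) H"
      unfolding H_def case_prod_beta by (intro continuous_intros)
    fix t :: real assume t: "t \<in> {0..1}"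
    show "inj (\<lambda>x. H (t, x))"
    proof -
      have main: "s = 0" if "H (t, p) = H (t, p + s *\<^sub>R e)" "0 \<le> s" for p s
      proof -
        have "(s - t * (\<psi> (p + s *\<^sub>R e) - \<psi> p)) *\<^sub>R e = 0"
          using that(1) by (simp add: H_def algebra_simps)
        then have "s = t * (\<psi> (p + s *\<^sub>R e) - \<psi> p)"
          using e by simp
        also have "\<dots> \<le> t * (c * s)"
          using t slope[OF that(2)] by (intro mult_left_mono) auto
        finally have "s * (1 - t * c) \<le> 0"
          by (simp add: algebra_simps)
        moreover have "t * c < 1"
          using t c mult_left_le_one_le[of c t] mult_nonneg_nonpos[of t c]
          by (cases "0 \<le> c") auto
        ultimately show ?thesis
          using that(2) by (simp add: mult_le_0_iff)
      qed
      show ?thesis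
      proof (rule injI)
        fix p q assume eq: "H (t, p) = H (t, q)"
        \<comment> \<open>Points with the same image lie on a common line in direction \<open>e\<close>.\<close>
        define s where "s = t * \<psi> q - t * \<psi> p"
        have q: "q = p + s *\<^sub>R e"
          using eq by (simp add: H_def s_def algebra_simps)
        then have p: "p = q + (- s) *\<^sub>R e"
          by simp
        show "p = q"
        proof (cases "0 \<le> s")
          case True
          then show ?thesis using main[of p s] eq q by simp
        next
          case False
          then show ?thesis using main[of q "- s"] eq p by simp
        qed
      qed
    qed
    show "surj (\<lambda>x. H (t, x))"
    proof (unfold surj_def, intro allI)
      fix y :: "real^3"
      let ?f = "\<lambda>s. s - t * \<psi> (y + s *\<^sub>R e)"
      obtain b where b: "\<And>s. s \<ge> b \<Longrightarrow> \<psi> (y + s *\<^sub>R e) = 0"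
        using vanish by blast
      have "continuous_on {0..max 0 b} (\<lambda>s. \<psi> (y + s *\<^sub>R e))"
        by (rule continuous_on_compose2[OF cont]) (auto intro!: continuous_intros)
      then have "continuous_on {0..max 0 b} ?f"
        by (intro continuous_intros)
      moreover have "?f 0 \<le> 0"
        using t nonneg by simp
      moreover have "0 \<le> ?f (max 0 b)"
        using b[of "max 0 b"] by simp
      ultimately obtain s where s: "?f s = 0"
        using IVT'[of ?f 0 0 "max 0 b"] by auto
      have "H (t, y + s *\<^sub>R e) = y + ?f s *\<^sub>R e"
        by (simp add: H_def algebra_simps)
      then show "\<exists>x. y = H (t, x)"
        using s by (metis add.right_neutral scaleR_zero_left)
    qed
  qed (simp_all add: H_def)
qed

section \<open>Triangle moves\<close>

text \<open>The triangle is put in the position with base from \<open>m - A\<close> to \<open>m + A\<close> and apex \<open>m + B\<close>.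
  Two coordinates \<open>xc\<close>, \<open>yc\<close> measure along \<open>A\<close> and \<open>B\<close>; the third, \<open>zc\<close>, is the distance to the
  plane of the triangle within the fibre where \<open>xc\<close> and \<open>yc\<close> are constant. In these coordinates the
  triangle is \<open>0 \<le> yc \<le> 1 - \<bar>xc\<bar>\<close>, \<open>zc = 0\<close>.\<close>

locale triangle_frame =
  fixes u v w :: "real^3" and X Y :: "real^3 \<Rightarrow> real"
  fixes m A B
  defines "m \<equiv> (1/2) *\<^sub>R (u + w)" and "A \<equiv> (1/2) *\<^sub>R (w - u)" and "B \<equiv> v - m"
  assumes linear_X: "linear X" and linear_Y: "linear Y"
    and dual: "X A = 1" "X B = 0" "Y A = 0" "Y B = 1"
begin

definition xc where "xc p = X (p - m)"
definition yc where "yc p = Y (p - m)"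
definition zc where "zc p = norm (p - m - xc p *\<^sub>R A - yc p *\<^sub>R B)"
definition width where "width p = 1 - \<bar>xc p\<bar>"

lemma u_eq: "u = m + (-1) *\<^sub>R A" and w_eq: "w = m + 1 *\<^sub>R A" and v_eq: "v = m + B"
  by (simp_all add: m_def A_def B_def vec_eq_iff field_simps)

lemmas linear_rules = linear_add[OF linear_X] linear_diff[OF linear_X] linear_scale[OF linear_X]
  linear_add[OF linear_Y] linear_diff[OF linear_Y] linear_scale[OF linear_Y] linear_0[OF linear_X] linear_0[OF linear_Y]

lemma coords_plane: "xc (m + a *\<^sub>R A + b *\<^sub>R B) = a" "yc (m + a *\<^sub>R A + b *\<^sub>R B) = b"
    "zc (m + a *\<^sub>R A + b *\<^sub>R B) = 0"
proof -
  show 1: "xc (m + a *\<^sub>R A + b *\<^sub>R B) = a" and 2: "yc (m + a *\<^sub>R A + b *\<^sub>R B) = b"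
    by (simp_all add: xc_def yc_def linear_rules dual)
  show "zc (m + a *\<^sub>R A + b *\<^sub>R B) = 0"
    unfolding zc_def 1 2 by simp
qed

lemma coords_shift: "xc (p + s *\<^sub>R B) = xc p" "yc (p + s *\<^sub>R B) = yc p + s" "zc (p + s *\<^sub>R B) = zc p"
proof -
  show 1: "xc (p + s *\<^sub>R B) = xc p" and 2: "yc (p + s *\<^sub>R B) = yc p + s"
    by (simp_all add: xc_def yc_def linear_rules dual)
  show "zc (p + s *\<^sub>R B) = zc p"
    unfolding zc_def 1 2 by (simp add: algebra_simps)
qed

lemma width_shift: "width (p + s *\<^sub>R B) = width p"
  by (simp only: width_def coords_shift)

lemma zc_nonneg: "0 \<le> zc p"
  by (simp add: zc_def)

lemma continuous_coords: "continuous_on UNIV xc" "continuous_on UNIV yc" "continuous_on UNIV zc"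
proof -
  have shift: "continuous_on UNIV (\<lambda>p. p - m)"
    by (intro continuous_on_diff continuous_on_id continuous_on_const)
  have X: "continuous_on UNIV (\<lambda>p. X (p - m))" and Y: "continuous_on UNIV (\<lambda>p. Y (p - m))"
    by (rule linear_continuous_on_compose[OF shift linear_X], rule linear_continuous_on_compose[OF shift linear_Y])
  show 1: "continuous_on UNIV xc" "continuous_on UNIV yc"
    using X Y by (simp_all add: xc_def[abs_def] yc_def[abs_def])
  show "continuous_on UNIV zc"
    unfolding zc_def[abs_def] by (intro continuous_intros 1)
qed

text \<open>A lens is a thin neighbourhood of the triangle without its base vertices. Its thickness is
  proportional to \<open>width\<close>, so near a base vertex it is a narrow cone, and an edge that leaves this
  vertex transversally to the plane of the triangle can stay outside.\<close>

definition lens where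
  "lens \<delta> = {p. zc p * (1 + 1/\<delta>) < yc p + \<delta> * width p \<and> yc p + zc p < (1 + \<delta>) * width p}"

lemma lens_bounds:
  assumes "0 < \<delta>" "p \<in> lens \<delta>"
  shows "0 < width p" "zc p < \<delta> * width p" "- \<delta> * width p < yc p" "yc p < (1 + \<delta>) * width p"
proof -
  have z: "0 \<le> zc p" "0 \<le> zc p / \<delta>"
    using assms(1) by (simp_all add: zc_nonneg)
  have l: "zc p + zc p / \<delta> < yc p + \<delta> * width p" "yc p + zc p < (1 + \<delta>) * width p"
    using assms(2) by (simp_all add: lens_def algebra_simps)
  have "zc p * (2 + 1/\<delta>) < (1 + 2 * \<delta>) * width p"
    using l by (simp add: algebra_simps)
  then have "zc p * (2 + 1/\<delta>) * \<delta> < (1 + 2 * \<delta>) * width p * \<delta>"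
    using assms(1) by (rule mult_strict_right_mono)
  moreover have "(2 + 1/\<delta>) * \<delta> = 1 + 2 * \<delta>"
    using assms(1) by (simp add: distrib_right)
  ultimately have "(1 + 2 * \<delta>) * zc p < (1 + 2 * \<delta>) * (\<delta> * width p)"
    by (metis mult.assoc mult.commute)
  then show zw: "zc p < \<delta> * width p"
    using assms(1) by (simp add: mult_less_cancel_left)
  then show "0 < width p"
    using z(1) assms(1) by (smt (verit) zero_less_mult_pos)
  show "- \<delta> * width p < yc p" "yc p < (1 + \<delta>) * width p"
    using z l by auto
qed

lemma lens_mono:
  assumes "0 < \<delta>" "\<delta> \<le> \<epsilon>"
  shows "lens \<delta> \<subseteq> lens \<epsilon>"
proof
  fix p assume p: "p \<in> lens \<delta>"
  have "0 < width p"
    using lens_bounds[OF assms(1) p] by simp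
  then have "\<delta> * width p \<le> \<epsilon> * width p"
    using assms(2) by simp
  moreover have "zc p / \<epsilon> \<le> zc p / \<delta>"
    using assms zc_nonneg[of p] by (simp add: frac_le)
  ultimately show "p \<in> lens \<epsilon>"
    using p by (simp add: lens_def algebra_simps)
qed

text \<open>The height of the shear: on the plane of the triangle it is, along each line in direction \<open>B\<close>, a
  piecewise linear hat with value \<open>width\<close> at \<open>yc = width\<close>, that is, on the two legs. Hence the shear
  drops the legs exactly onto the base. The rising side of the hat has slope \<open>1 / (1 + \<delta>) < 1\<close>.\<close>

definition push where
  "push \<delta> p = max 0 (min ((yc p + \<delta> * width p) / (1 + \<delta>) - zc p / \<delta>)
                          (((1 + \<delta>) * width p - yc p - zc p) / \<delta>))"

lemma push_outside:
  assumes "0 < \<delta>" "p \<notin> lens \<delta>"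
  shows "push \<delta> p = 0"
proof -
  consider "yc p + \<delta> * width p \<le> zc p * (1 + 1/\<delta>)" | "(1 + \<delta>) * width p \<le> yc p + zc p"
    using assms(2) unfolding lens_def mem_Collect_eq by linarith
  then show ?thesis
  proof cases
    case 1
    have "1 + 1/\<delta> = (1 + \<delta>) / \<delta>"
      using assms(1) by (simp add: add_divide_distrib)
    then have "zc p * (1 + 1/\<delta>) / (1 + \<delta>) = zc p / \<delta>"
      using assms(1) by simp
    then have "(yc p + \<delta> * width p) / (1 + \<delta>) \<le> zc p / \<delta>"
      using divide_right_mono[OF 1, of "1 + \<delta>"] assms(1) by simp
    then show ?thesis
      unfolding push_def by (intro max_absorb1 min.coboundedI1) simp
  next
    case 2
    then have "((1 + \<delta>) * width p - yc p - zc p) / \<delta> \<le> 0"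
      using assms(1) by (intro divide_nonpos_pos) simp_all
    then show ?thesis
      unfolding push_def by (intro max_absorb1 min.coboundedI2)
  qed
qed

lemma push_legs:
  assumes "0 < \<delta>" "0 \<le> s" "s \<le> 1" "\<bar>\<sigma>\<bar> = 1"
  shows "push \<delta> (m + (\<sigma> * (1 - s)) *\<^sub>R A + s *\<^sub>R B) = s"
proof -
  have "width (m + (\<sigma> * (1 - s)) *\<^sub>R A + s *\<^sub>R B) = s"
    using assms by (simp add: width_def coords_plane abs_mult)
  moreover have "(s + \<delta> * s) / (1 + \<delta>) = s" "((1 + \<delta>) * s - s) / \<delta> = s"
    using assms(1) by (simp_all add: field_simps)
  ultimately show ?thesis
    using assms(2) by (simp add: push_def coords_plane)
qed

lemma ambient_isotopic_push:
  assumes "0 < \<delta>"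
  shows "ambient_isotopic K ((\<lambda>p. p - push \<delta> p *\<^sub>R B) ` K)"
proof (rule ambient_isotopic_shear[where c = "1 / (1 + \<delta>)"])
  show "continuous_on UNIV (push \<delta>)"
  proof -
    have width: "continuous_on UNIV width"
      unfolding width_def[abs_def] by (intro continuous_on_diff continuous_on_const continuous_on_rabs continuous_coords)
    show ?thesis
      unfolding push_def[abs_def] using assms
      by (intro continuous_on_max continuous_on_min continuous_on_diff continuous_on_divide continuous_on_add
          continuous_on_mult continuous_on_const continuous_coords width) auto
  qed
  show "0 \<le> push \<delta> p" for p
    by (simp add: push_def)
  show "1 / (1 + \<delta>) < 1"
    using assms by simp
  show "push \<delta> (p + s *\<^sub>R B) - push \<delta> p \<le> 1 / (1 + \<delta>) * s" if "0 \<le> s" for p s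
  proof -
    have clip: "max 0 (min a' b') - max 0 (min a b) \<le> k" if "a' = a + k" "b' \<le> b" "0 \<le> k"
      for a a' b b' k :: real
      using that by linarith
    show ?thesis
      unfolding push_def coords_shift width_shift
    proof (rule clip)
      show "(yc p + s + \<delta> * width p) / (1 + \<delta>) - zc p / \<delta> =
          (yc p + \<delta> * width p) / (1 + \<delta>) - zc p / \<delta> + 1 / (1 + \<delta>) * s"
        by (simp only: add_divide_distrib) simp
      show "((1 + \<delta>) * width p - (yc p + s) - zc p) / \<delta> \<le> ((1 + \<delta>) * width p - yc p - zc p) / \<delta>"
        using assms that by (intro divide_right_mono diff_mono order_refl) simp_all
      show "0 \<le> 1 / (1 + \<delta>) * s"
        using assms that by simp
    qed
  qed
  show "\<exists>b. \<forall>s\<ge>b. push \<delta> (p + s *\<^sub>R B) = 0" for p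
  proof (intro exI[of _ "(1 + \<delta>) * width p - yc p"] allI impI)
    fix s assume "(1 + \<delta>) * width p - yc p \<le> s"
    then have "\<not> yc p + s + zc p < (1 + \<delta>) * width p"
      using zc_nonneg[of p] by linarith
    then have "p + s *\<^sub>R B \<notin> lens \<delta>"
      unfolding lens_def mem_Collect_eq coords_shift width_shift by blast
    then show "push \<delta> (p + s *\<^sub>R B) = 0"
      by (rule push_outside[OF assms])
  qed
qed

lemma push_image_legs:
  assumes "0 < \<delta>"
  shows "(\<lambda>p. p - push \<delta> p *\<^sub>R B) ` (closed_segment u v \<union> closed_segment v w) = closed_segment u w"
proof -
  have leg: "(\<lambda>p. p - push \<delta> p *\<^sub>R B) ` closed_segment (m + \<sigma> *\<^sub>R A) v = closed_segment (m + \<sigma> *\<^sub>R A) m"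
    if "\<bar>\<sigma>\<bar> = 1" for \<sigma>
  proof -
    have "(\<lambda>p. p - push \<delta> p *\<^sub>R B) ((1 - s) *\<^sub>R (m + \<sigma> *\<^sub>R A) + s *\<^sub>R v)
        = (1 - s) *\<^sub>R (m + \<sigma> *\<^sub>R A) + s *\<^sub>R m" if "0 \<le> s" "s \<le> 1" for s
    proof -
      have p: "(1 - s) *\<^sub>R (m + \<sigma> *\<^sub>R A) + s *\<^sub>R v = m + (\<sigma> * (1 - s)) *\<^sub>R A + s *\<^sub>R B"
        by (simp add: v_eq algebra_simps)
      show ?thesis
        unfolding p push_legs[OF assms that \<open>\<bar>\<sigma>\<bar> = 1\<close>] by (simp add: algebra_simps)
    qed
    then show ?thesis
      unfolding closed_segment_image_interval image_image by (intro image_cong) auto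
  qed
  have "m \<in> closed_segment u w"
    unfolding m_def by (metis midpoint_def midpoint_in_closed_segment inverse_eq_divide)
  then have "closed_segment u m \<union> closed_segment w m = closed_segment u w"
    by (metis Un_closed_segment closed_segment_commute)
  then show ?thesis
    using leg[of "-1"] leg[of 1] unfolding image_Un u_eq[symmetric] w_eq[symmetric]
    by (simp add: closed_segment_commute)
qed

text \<open>All points of the lens are within distance \<open>\<delta> * (1 + norm B)\<close> of the triangle: clamping \<open>yc\<close> to
  the interval from 0 to \<open>width\<close> and dropping the transversal part moves them no further.\<close>

lemma lens_avoids_compact:
  assumes "compact S" "S \<inter> convex hull {u, v, w} = {}"
  shows "\<exists>\<delta>>0. S \<inter> lens \<delta> = {}"
proof -
  obtain d where d: "d > 0" "\<And>p q. p \<in> S \<Longrightarrow> q \<in> convex hull {u, v, w} \<Longrightarrow> d \<le> dist p q"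
    using separate_compact_closed[OF assms(1) _ assms(2)]
    by (metis compact_imp_closed finite.emptyI finite.insertI finite_imp_compact_convex_hull)
  define \<delta> where "\<delta> = d / (1 + norm B)"
  have nB: "0 < 1 + norm B"
    by (simp add: add_pos_nonneg)
  have \<delta>: "0 < \<delta>"
    using d(1) nB by (simp add: \<delta>_def)
  have "p \<notin> S" if p: "p \<in> lens \<delta>" for p
  proof
    assume "p \<in> S"
    note b = lens_bounds[OF \<delta> p]
    have w1: "width p \<le> 1"
      by (simp add: width_def)
    then have dw: "\<delta> * width p \<le> \<delta>"
      using \<delta> by simp
    define y where "y = max 0 (min (yc p) (width p))"
    have "- \<delta> < yc p" "yc p < width p + \<delta>"
      using b(3,4) dw by (simp_all add: algebra_simps)
    then have y: "0 \<le> y" "y \<le> width p" "\<bar>yc p - y\<bar> \<le> \<delta>"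
      using b(1) \<delta> unfolding y_def by linarith+
    define q where "q = m + xc p *\<^sub>R A + y *\<^sub>R B"
    have "q = ((1 - y - xc p) / 2) *\<^sub>R u + y *\<^sub>R v + ((1 - y + xc p) / 2) *\<^sub>R w"
      unfolding q_def u_eq v_eq w_eq by (simp add: vec_eq_iff field_simps)
    moreover have "0 \<le> (1 - y - xc p) / 2" "0 \<le> (1 - y + xc p) / 2"
      using y unfolding width_def by auto
    moreover have "(1 - y - xc p) / 2 + y + (1 - y + xc p) / 2 = 1"
      by (simp add: field_simps)
    ultimately have "q \<in> convex hull {u, v, w}"
      unfolding convex_hull_3 using y(1) by blast
    then have "d \<le> norm (p - q)"
      using d(2) \<open>p \<in> S\<close> by (simp add: dist_norm)
    also have "p - q = (p - m - xc p *\<^sub>R A - yc p *\<^sub>R B) + (yc p - y) *\<^sub>R B"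
      by (simp add: q_def algebra_simps)
    also have "norm \<dots> \<le> zc p + \<bar>yc p - y\<bar> * norm B"
      unfolding zc_def by (metis norm_scaleR norm_triangle_ineq)
    also have "\<dots> < \<delta> + \<delta> * norm B"
      using b(2) dw y(3) by (smt (verit) mult_right_mono norm_ge_zero)
    also have "\<dots> = d"
    proof -
      have "\<delta> * (1 + norm B) = d"
        using nB by (simp add: \<delta>_def)
      then show ?thesis
        by (simp add: distrib_left)
    qed
    finally show False by simp
  qed
  then show ?thesis
    using \<delta> by blast
qed

text \<open>Along a segment that leaves a base vertex transversally, both \<open>zc\<close> and the bound on \<open>width\<close> grow
  linearly, so a small \<open>\<delta>\<close> keeps their ratio outside the lens at every scale.\<close>

lemma lens_avoids_segment:
  assumes a: "a \<in> {u, w}" and x: "x \<notin> affine hull {u, v, w}"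
  shows "\<exists>\<delta>>0. closed_segment a x \<inter> lens \<delta> = {}"
proof -
  obtain \<sigma> :: real where \<sigma>: "\<bar>\<sigma>\<bar> = 1" "a = m + \<sigma> *\<^sub>R A + 0 *\<^sub>R B"
    using a u_eq w_eq by (auto intro: that[of 1] that[of "-1"])
  define \<xi> where "\<xi> = X (x - a)"
  have "x \<noteq> m + xc x *\<^sub>R A + yc x *\<^sub>R B"
  proof
    assume "x = m + xc x *\<^sub>R A + yc x *\<^sub>R B"
    also have "\<dots> = ((1 - yc x - xc x) / 2) *\<^sub>R u + yc x *\<^sub>R v + ((1 - yc x + xc x) / 2) *\<^sub>R w"
      unfolding u_eq v_eq w_eq by (simp add: vec_eq_iff field_simps)
    finally have "x \<in> affine hull {u, v, w}"
      unfolding affine_hull_3 by (intro CollectI exI conjI) (assumption, simp add: field_simps)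
    then show False using x by simp
  qed
  then have z: "0 < zc x"
    by (simp add: zc_def algebra_simps)
  define \<delta> where "\<delta> = zc x / (1 + \<bar>\<xi>\<bar>)"
  have \<delta>: "0 < \<delta>" "\<delta> * \<bar>\<xi>\<bar> < zc x"
    using z by (simp_all add: \<delta>_def divide_less_eq algebra_simps)
  have "p \<notin> lens \<delta>" if "p \<in> closed_segment a x" for p
  proof
    assume p: "p \<in> lens \<delta>"
    obtain s where s: "0 \<le> s" "p = a + s *\<^sub>R (x - a)"
      using \<open>p \<in> closed_segment a x\<close> unfolding closed_segment_def by (auto simp: algebra_simps)
    have am: "X (a - m) = \<sigma>" "Y (a - m) = 0"
      using coords_plane[of \<sigma> 0] \<sigma>(2) by (simp_all add: xc_def yc_def)
    have sp: "p - m = (a - m) + s *\<^sub>R ((x - m) - (a - m))"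
      using s(2) by simp
    have xp: "xc p = \<sigma> + s * (xc x - \<sigma>)" and yp: "yc p = s * yc x"
    proof -
      have "X (b + s *\<^sub>R (c - b)) = X b + s * (X c - X b)" "Y (b + s *\<^sub>R (c - b)) = Y b + s * (Y c - Y b)" for b c
        by (simp_all add: linear_rules)
      then show "xc p = \<sigma> + s * (xc x - \<sigma>)" "yc p = s * yc x"
        unfolding xc_def yc_def sp by (simp_all only: am) simp
    qed
    have \<xi>: "\<xi> = xc x - \<sigma>"
      using am by (simp add: \<xi>_def xc_def linear_rules)
    have "zc p = norm (s *\<^sub>R (x - m - xc x *\<^sub>R A - yc x *\<^sub>R B))"
      unfolding zc_def xp yp sp using \<sigma>(2) by (simp add: algebra_simps)
    then have zp: "zc p = s * zc x"
      using s(1) by (simp add: zc_def)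
    have wp: "width p \<le> s * \<bar>\<xi>\<bar>"
      using \<sigma>(1) abs_triangle_ineq[of "\<sigma> + s * \<xi>" "- (s * \<xi>)"] s(1)
      unfolding width_def xp \<xi>[symmetric] by (simp add: abs_mult)
    note b = lens_bounds[OF \<delta>(1) p]
    have "s * zc x < \<delta> * width p"
      using b(2) zp by simp
    also have "\<dots> \<le> \<delta> * (s * \<bar>\<xi>\<bar>)"
      using wp \<delta>(1) by simp
    also have "\<dots> \<le> s * zc x"
      using \<delta>(2) s(1) by (metis less_imp_le mult.left_commute mult_left_mono)
    finally show False by simp
  qed
  then show ?thesis
    using \<delta>(1) by blast
qed

end

lemma triangle_frame_exists:
  fixes u v w :: "real^3"
  assumes "\<not> collinear {u, v, w}"
  obtains X Y where "triangle_frame u v w X Y"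
proof -
  define A where "A = (1/2) *\<^sub>R (w - u)"
  define B where "B = v - (1/2) *\<^sub>R (u + w)"
  have uw: "u \<noteq> w" and on_line: "\<And>k. v \<noteq> k *\<^sub>R u + (1 - k) *\<^sub>R w"
    using assms by (auto simp: collinear_3_expand)
  have A: "A \<noteq> 0"
    using uw by (simp add: A_def)
  have BA: "B \<notin> span {A}"
  proof
    assume "B \<in> span {A}"
    then obtain k where "B = k *\<^sub>R A"
      by (auto simp: span_singleton)
    then have "v = ((1 - k) / 2) *\<^sub>R u + (1 - (1 - k) / 2) *\<^sub>R w"
      by (simp add: A_def B_def vec_eq_iff field_simps)
    then show False
      using on_line by blast
  qed
  then have "B \<noteq> A" and ind: "independent {B, A}"
    using A span_base[of A "{A}"] by (auto simp: independent_insert)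
  obtain X where X: "linear X" "\<forall>x\<in>{B, A}. X x = (if x = A then 1 else 0 :: real)"
    using linear_independent_extend[OF ind, of "\<lambda>x. if x = A then 1 else 0 :: real"] by blast
  obtain Y where Y: "linear Y" "\<forall>x\<in>{B, A}. Y x = (if x = B then 1 else 0 :: real)"
    using linear_independent_extend[OF ind, of "\<lambda>x. if x = B then 1 else 0 :: real"] by blast
  have "X A = 1" "X B = 0" "Y A = 0" "Y B = 1"
    using X(2) Y(2) \<open>B \<noteq> A\<close> by simp_all
  then have "triangle_frame u v w X Y"
    using X(1) Y(1) unfolding A_def B_def by (intro triangle_frame.intro)
  then show ?thesis by (rule that)
qed

text \<open>The elementary move of polygonal knot theory: two sides of a triangle may be replaced by the
  third if the rest of the curve meets the triangle only at the two vertices that are kept. The rest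
  is given as a finite family of pieces, so that one lens can be chosen to avoid them all.\<close>

lemma triangle_move:
  fixes u v w :: "real^3"
  assumes nc: "\<not> collinear {u, v, w}" and fin: "finite \<S>"
    and \<S>: "\<And>S. S \<in> \<S> \<Longrightarrow> compact S \<and> S \<inter> convex hull {u, v, w} = {} \<or>
              (\<exists>a\<in>{u, w}. \<exists>x. x \<notin> affine hull {u, v, w} \<and> S = closed_segment a x)"
  shows "ambient_isotopic (closed_segment u v \<union> closed_segment v w \<union> \<Union>\<S>) (closed_segment u w \<union> \<Union>\<S>)"
proof -
  obtain X Y where "triangle_frame u v w X Y"
    using triangle_frame_exists[OF nc] .
  then interpret triangle_frame u v w X Y "(1/2) *\<^sub>R (u + w)" "(1/2) *\<^sub>R (w - u)" "v - (1/2) *\<^sub>R (u + w)" .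
  have "\<exists>\<delta>>0. \<Union>\<S> \<inter> lens \<delta> = {}"
    using fin \<S>
  proof (induction \<S> rule: finite_induct)
    case empty
    show ?case by (auto intro: exI[of _ 1])
  next
    case (insert S \<S>)
    obtain \<delta> where \<delta>: "\<delta> > 0" "\<Union>\<S> \<inter> lens \<delta> = {}"
      using insert.IH insert.prems by blast
    obtain \<epsilon> where \<epsilon>: "\<epsilon> > 0" "S \<inter> lens \<epsilon> = {}"
      using insert.prems[of S] lens_avoids_compact[of S] lens_avoids_segment by blast
    have "lens (min \<delta> \<epsilon>) \<subseteq> lens \<delta>" "lens (min \<delta> \<epsilon>) \<subseteq> lens \<epsilon>"
      using \<delta>(1) \<epsilon>(1) by (simp_all add: lens_mono)
    then show ?case
      using \<delta> \<epsilon> by (intro exI[of _ "min \<delta> \<epsilon>"]) auto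
  qed
  then obtain \<delta> where \<delta>: "\<delta> > 0" "\<Union>\<S> \<inter> lens \<delta> = {}"
    by blast
  let ?h = "\<lambda>p. p - push \<delta> p *\<^sub>R (v - (1/2) *\<^sub>R (u + w))"
  have fixed: "?h p = p" if "p \<in> \<Union>\<S>" for p
    using push_outside[OF \<delta>(1), of p] \<delta>(2) that by auto
  have "?h ` \<Union>\<S> = (\<lambda>p. p) ` \<Union>\<S>"
    by (intro image_cong refl fixed)
  then have "?h ` \<Union>\<S> = \<Union>\<S>"
    by simp
  then have image: "?h ` (closed_segment u v \<union> closed_segment v w \<union> \<Union>\<S>) = closed_segment u w \<union> \<Union>\<S>"
    by (subst image_Un) (simp only: push_image_legs[OF \<delta>(1)])
  show ?thesis
    by (subst image[symmetric]) (rule ambient_isotopic_push[OF \<delta>(1)])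
qed

section \<open>Triangles are unknotted\<close>

text \<open>Six times the signed volume of the tetrahedron. Its vanishing is invariant under permutations of
  the four points, which makes it a convenient certificate of general position.\<close>

definition vol :: "real^3 \<Rightarrow> real^3 \<Rightarrow> real^3 \<Rightarrow> real^3 \<Rightarrow> real" where
  "vol p q r s = (q - p) \<bullet> cross3 (r - p) (s - p)"

lemma vol_swap: "vol q p r s = - vol p q r s" "vol p r q s = - vol p q r s" "vol p q s r = - vol p q r s"
  by (simp_all add: vol_def cross3_simps)

lemma vol_eq_0_iff_swap: "vol q p r s = 0 \<longleftrightarrow> vol p q r s = 0" "vol p r q s = 0 \<longleftrightarrow> vol p q r s = 0"
    "vol p q s r = 0 \<longleftrightarrow> vol p q r s = 0"
  using vol_swap[of p q r s] by (metis neg_equal_0_iff_equal)+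

lemma affine_hull_imp_vol_0:
  assumes "s \<in> affine hull {p, q, r}"
  shows "vol p q r s = 0"
proof -
  obtain a b c where abc: "a + b + c = 1" "s = a *\<^sub>R p + b *\<^sub>R q + c *\<^sub>R r"
    using assms unfolding affine_hull_3 by blast
  then have "a = 1 - b - c"
    by simp
  have "s - p = b *\<^sub>R (q - p) + c *\<^sub>R (r - p)"
    unfolding abc(2) \<open>a = 1 - b - c\<close> by (simp add: algebra_simps)
  then show ?thesis
    by (simp add: vol_def cross_add_right cross_mult_right inner_add_right dot_cross_self)
qed

lemma collinear_imp_vol_0:
  assumes "collinear {p, q, r}"
  shows "vol p q r s = 0"
proof (cases "p = r")
  case True
  then show ?thesis by (simp add: vol_def)
next
  case False
  then obtain a where "q = a *\<^sub>R p + (1 - a) *\<^sub>R r + 0 *\<^sub>R s"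
    using assms by (auto simp: collinear_3_expand)
  then have "q \<in> affine hull {p, r, s}"
    unfolding affine_hull_3 by (intro CollectI exI conjI) (assumption, simp)
  then have "vol p r s q = 0"
    by (rule affine_hull_imp_vol_0)
  then show ?thesis
    using vol_swap by (metis neg_equal_0_iff_equal)
qed

definition triangle_boundary :: "real^3 \<Rightarrow> real^3 \<Rightarrow> real^3 \<Rightarrow> (real^3) set" where
  "triangle_boundary u v w = closed_segment u v \<union> closed_segment v w \<union> closed_segment w u"

lemma triangle_boundary_rotate: "triangle_boundary v w u = triangle_boundary u v w"
  by (auto simp: triangle_boundary_def)

lemma quadrilateral_isotopic_triangle:
  assumes "vol u v w x \<noteq> 0"
  shows "ambient_isotopic (closed_segment u v \<union> closed_segment v w \<union> (closed_segment w x \<union> closed_segment x u))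
           (triangle_boundary u w x)"
proof -
  have "\<not> collinear {u, v, w}" and x: "x \<notin> affine hull {u, v, w}"
    using assms affine_hull_imp_vol_0 collinear_imp_vol_0 by blast+
  then have "ambient_isotopic (closed_segment u v \<union> closed_segment v w \<union> \<Union>{closed_segment w x, closed_segment u x})
          (closed_segment u w \<union> \<Union>{closed_segment w x, closed_segment u x})"
    by (intro triangle_move) auto
  then show ?thesis
    by (simp add: triangle_boundary_def closed_segment_commute Un_assoc)
qed

text \<open>With \<open>v'\<close> off the plane, the skew quadrilateral \<open>u v w v'\<close> shrinks to either triangle.\<close>

lemma triangle_replace_vertex:
  assumes "vol u v w v' \<noteq> 0"
  shows "ambient_isotopic (triangle_boundary u v w) (triangle_boundary u v' w)"
proof -
  let ?Q = "closed_segment u v \<union> closed_segment v w \<union> (closed_segment w v' \<union> closed_segment v' u)"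
  have "vol w v' u v \<noteq> 0"
    using assms vol_eq_0_iff_swap by metis
  then have "ambient_isotopic ?Q (triangle_boundary w u v)"
    using quadrilateral_isotopic_triangle[of w v' u v] by (simp add: Un_commute)
  moreover have "ambient_isotopic ?Q (triangle_boundary u w v')"
    by (rule quadrilateral_isotopic_triangle) (fact assms)
  moreover have "triangle_boundary w u v = triangle_boundary u v w" "triangle_boundary u w v' = triangle_boundary u v' w"
    by (auto simp: triangle_boundary_def closed_segment_commute)
  ultimately show ?thesis
    using ambient_isotopic_sym ambient_isotopic_trans by metis
qed

text \<open>A star-shaped surface around the origin is the unit sphere of a gauge \<open>g\<close>. Multiplying each
  point by the interpolation \<open>\<rho>\<close> between 1 and \<open>g p / norm p\<close> deforms it radially to the round sphere;
  this factor is constant along rays, so the rays are preserved and each is stretched linearly. The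
  cone \<open>C\<close> is carried along, so that the same isotopy serves for plane curves.\<close>

lemma ambient_isotopic_gauge_sphere:
  fixes g :: "real^3 \<Rightarrow> real"
  assumes cont: "continuous_on UNIV g"
    and homog: "\<And>c p. 0 \<le> c \<Longrightarrow> g (c *\<^sub>R p) = c * g p"
    and pos: "\<And>p. p \<noteq> 0 \<Longrightarrow> 0 < g p"
    and cone: "\<And>c p. 0 \<le> c \<Longrightarrow> p \<in> C \<Longrightarrow> c *\<^sub>R p \<in> C"
  shows "ambient_isotopic {p \<in> C. g p = 1} {p \<in> C. norm p = 1}"
proof -
  define k where "k p = (g p / norm p) *\<^sub>R p" for p
  define \<rho> where "\<rho> t p = (1 - t) + t * (g p / norm p)" for t p
  define H where "H = (\<lambda>(t, p). (1 - t) *\<^sub>R p + t *\<^sub>R k p)"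
  have H: "H (t, p) = \<rho> t p *\<^sub>R p" for t p
    by (simp add: H_def k_def \<rho>_def scaleR_add_left)
  have g0: "g 0 = 0"
    using homog[of 0 0] by simp
  have \<rho>_pos: "0 < \<rho> t p" if "t \<in> {0..1}" "p \<noteq> 0" for t p
  proof (cases "t = 1")
    case True
    then show ?thesis using pos that by (simp add: \<rho>_def)
  next
    case False
    then show ?thesis
      using that pos[OF that(2)] unfolding \<rho>_def by (intro add_pos_nonneg) auto
  qed
  have \<rho>_scale: "\<rho> t (c *\<^sub>R p) = \<rho> t p" if "0 < c" for t c p
    using that by (simp add: \<rho>_def homog)
  have "isCont k p" for p
  proof (cases "p = 0")
    case True
    have "norm (k q) = \<bar>g q\<bar>" for q
      by (cases "q = 0") (simp_all add: k_def g0)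
    moreover have "(g \<longlongrightarrow> 0) (at 0)"
      using cont g0 by (metis UNIV_I continuous_on_eq_continuous_at isCont_def open_UNIV)
    ultimately have "((\<lambda>q. norm (k q)) \<longlongrightarrow> 0) (at 0)"
      by (simp add: tendsto_rabs_zero)
    then have "(k \<longlongrightarrow> 0) (at 0)"
      by (rule tendsto_norm_zero_cancel)
    then show ?thesis
      using True by (simp add: isCont_def k_def)
  next
    case False
    have "isCont g p"
      using cont by (simp add: continuous_on_eq_continuous_at)
    then show ?thesis
      unfolding k_def using False by (intro continuous_intros) auto
  qed
  then have k: "continuous_on UNIV k"
    by (simp add: continuous_on_eq_continuous_at)
  show ?thesis
  proof (rule ambient_isotopicI[of H])
    have "continuous_on ({0..1} \<times> UNIV) (\<lambda>q :: real \<times> (real^3). k (snd q))"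
      by (rule continuous_on_compose2[OF k]) (auto intro: continuous_intros)
    then show "continuous_on ({0..1} \<times> UNIV) H"
      unfolding H_def case_prod_beta by (intro continuous_intros)
    show "H (0, p) = p" for p
      by (simp add: H_def)
    fix t :: real assume t: "t \<in> {0..1}"
    have nonzero: "H (t, p) = 0 \<longleftrightarrow> p = 0" for p
      using \<rho>_pos[OF t, of p] by (cases "p = 0") (simp_all add: H)
    show "inj (\<lambda>x. H (t, x))"
    proof (rule injI)
      fix p q assume eq: "H (t, p) = H (t, q)"
      show "p = q"
      proof (cases "p = 0")
        case True
        then show ?thesis using eq nonzero by metis
      next
        case False
        then have "q \<noteq> 0"
          using eq nonzero by metis
        define c where "c = \<rho> t p / \<rho> t q"
        have c: "0 < c"
          using \<rho>_pos[OF t False] \<rho>_pos[OF t \<open>q \<noteq> 0\<close>] by (simp add: c_def)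
        have "q = (1 / \<rho> t q) *\<^sub>R H (t, q)"
          using \<rho>_pos[OF t \<open>q \<noteq> 0\<close>] by (simp add: H)
        also have "\<dots> = c *\<^sub>R p"
          by (simp only: eq[symmetric]) (simp add: H c_def)
        finally have q: "q = c *\<^sub>R p" .
        then have "c = 1"
          using \<rho>_scale[OF c, of t p] \<rho>_pos[OF t False] by (simp add: c_def)
        then show ?thesis using q by simp
      qed
    qed
    show "surj (\<lambda>x. H (t, x))"
      unfolding surj_def
    proof
      fix y :: "real^3"
      show "\<exists>x. y = H (t, x)"
      proof (cases "y = 0")
        case True
        then show ?thesis using nonzero by metis
      next
        case False
        then have "H (t, (1 / \<rho> t y) *\<^sub>R y) = y"
          using \<rho>_pos[OF t False] \<rho>_scale[of "1 / \<rho> t y" t y] by (simp add: H)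
        then show ?thesis by metis
      qed
    qed
  next
    show "(\<lambda>p. H (1, p)) ` {p \<in> C. g p = 1} = {p \<in> C. norm p = 1}"
    proof (intro set_eqI iffI)
      fix q assume "q \<in> (\<lambda>p. H (1, p)) ` {p \<in> C. g p = 1}"
      then obtain p where p: "p \<in> C" "g p = 1" "q = (1 / norm p) *\<^sub>R p"
        by (auto simp: H \<rho>_def)
      moreover have "p \<noteq> 0"
        using p(2) g0 by auto
      ultimately show "q \<in> {p \<in> C. norm p = 1}"
        by (simp add: cone)
    next
      fix q assume q: "q \<in> {p \<in> C. norm p = 1}"
      then have q0: "q \<noteq> 0" "norm q = 1" "q \<in> C"
        by auto
      let ?p = "(1 / g q) *\<^sub>R q"
      have "g ?p = 1" "?p \<in> C"
        using pos[OF q0(1)] q0(3) by (simp_all add: homog cone less_imp_le)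
      moreover have "H (1, ?p) = q"
        using pos[OF q0(1)] q0(2) \<open>g ?p = 1\<close> by (simp add: H \<rho>_def)
      ultimately show "q \<in> (\<lambda>p. H (1, p)) ` {p \<in> C. g p = 1}"
        by (metis (mono_tags, lifting) image_eqI mem_Collect_eq)
    qed
  qed
qed

text \<open>The three linear forms in \<open>g\<close> have value 1 on the three sides; the term \<open>\<bar>p$3\<bar>\<close> makes
  \<open>g\<close> positive off the plane.\<close>

lemma standard_triangle_isotopic_circle:
  "ambient_isotopic (triangle_boundary (vector [1, 0, 0]) (vector [0, 1, 0]) (vector [-1, -1, 0])) standard_circle"
proof -
  define g :: "real^3 \<Rightarrow> real" where
    "g p = max (max (p$1 + p$2) (p$2 - 2 * p$1)) (max (p$1 - 2 * p$2) \<bar>p$3\<bar>)" for p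
  define C :: "(real^3) set" where "C = {p. p$3 = 0}"
  have "ambient_isotopic {p \<in> C. g p = 1} {p \<in> C. norm p = 1}"
  proof (rule ambient_isotopic_gauge_sphere)
    show "continuous_on UNIV g"
      unfolding g_def[abs_def]
      by (intro continuous_on_max continuous_on_add continuous_on_diff continuous_on_mult continuous_on_const
          continuous_on_rabs continuous_on_component continuous_on_id)
    show "g (c *\<^sub>R p) = c * g p" if "0 \<le> c" for c p
      using that by (simp add: g_def max_mult_distrib_left abs_mult algebra_simps)
    show "0 < g p" if "p \<noteq> 0" for p
    proof (rule ccontr)
      assume "\<not> 0 < g p"
      then have "p$1 + p$2 \<le> 0" "p$2 - 2 * p$1 \<le> 0" "p$1 - 2 * p$2 \<le> 0" "\<bar>p$3\<bar> \<le> 0"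
        by (auto simp: g_def)
      then have "p$1 = 0" "p$2 = 0" "p$3 = 0"
        by linarith+
      then show False
        using that by (simp add: vec_eq_iff forall_3)
    qed
  qed (simp add: C_def)
  moreover have "{p \<in> C. norm p = 1} = standard_circle"
    by (auto simp: C_def standard_circle_def)
  moreover have "{p \<in> C. g p = 1} = triangle_boundary (vector [1, 0, 0]) (vector [0, 1, 0]) (vector [-1, -1, 0])" (is "?L = ?R")
  proof (intro set_eqI iffI)
    fix p assume "p \<in> ?R"
    then obtain s where "0 \<le> s" "s \<le> 1" and
      "p = (1 - s) *\<^sub>R vector [1, 0, 0] + s *\<^sub>R vector [0, 1, 0] \<or>
       p = (1 - s) *\<^sub>R vector [0, 1, 0] + s *\<^sub>R vector [-1, -1, 0] \<or>
       p = (1 - s) *\<^sub>R vector [-1, -1, 0] + s *\<^sub>R vector [1, 0, 0]"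
      unfolding triangle_boundary_def closed_segment_def by blast
    then show "p \<in> ?L"
      by (elim disjE) (auto simp: C_def g_def)
  next
    fix p assume "p \<in> ?L"
    then have p3: "p$3 = 0" and le: "p$1 + p$2 \<le> 1" "p$2 - 2 * p$1 \<le> 1" "p$1 - 2 * p$2 \<le> 1"
      and eq: "p$1 + p$2 = 1 \<or> p$2 - 2 * p$1 = 1 \<or> p$1 - 2 * p$2 = 1"
      by (auto simp: C_def g_def max_def split: if_splits)
    from eq show "p \<in> ?R"
    proof (elim disjE)
      assume e: "p$1 + p$2 = 1"
      then have "p = (1 - p$2) *\<^sub>R vector [1, 0, 0] + p$2 *\<^sub>R vector [0, 1, 0]"
        using p3 by (simp add: vec_eq_iff forall_3)
      moreover have "0 \<le> p$2" "p$2 \<le> 1"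
        using e le by linarith+
      ultimately show ?thesis
        unfolding triangle_boundary_def closed_segment_def by blast
    next
      assume e: "p$2 - 2 * p$1 = 1"
      then have "p = (1 - (- p$1)) *\<^sub>R vector [0, 1, 0] + (- p$1) *\<^sub>R vector [-1, -1, 0]"
        using p3 by (simp add: vec_eq_iff forall_3)
      moreover have "0 \<le> - p$1" "- p$1 \<le> 1"
        using e le by linarith+
      ultimately show ?thesis
        unfolding triangle_boundary_def closed_segment_def by blast
    next
      assume e: "p$1 - 2 * p$2 = 1"
      then have "p = (1 - (1 + p$2)) *\<^sub>R vector [-1, -1, 0] + (1 + p$2) *\<^sub>R vector [1, 0, 0]"
        using p3 by (simp add: vec_eq_iff forall_3)
      moreover have "0 \<le> 1 + p$2" "1 + p$2 \<le> 1"
        using e le by linarith+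
      ultimately show ?thesis
        unfolding triangle_boundary_def closed_segment_def by blast
    qed
  qed
  ultimately show ?thesis
    by simp
qed

section \<open>The moment curve\<close>

definition moment :: "real \<Rightarrow> real^3" where
  "moment t = vector [t, t^2, t^3]"

lemma vol_moment: "vol (moment a) (moment b) (moment c) (moment d)
    = (b - a) * (c - a) * (d - a) * (c - b) * (d - b) * (d - c)"
  by (simp add: vol_def moment_def cross3_simps power2_eq_square power3_eq_cube)

lemma vol_moment_nonzero:
  assumes "distinct [a, b, c, d]"
  shows "vol (moment a) (moment b) (moment c) (moment d) \<noteq> 0"
  using assms by (simp add: vol_moment)

text \<open>A plane meets the moment curve in the zeros of a cubic polynomial, and every cubic with
  real roots arises. All incidence questions about points of the curve thus become questions about
  signs of cubics.\<close>

lemma plane_through_roots: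
  "\<exists>(n :: real^3) k. \<forall>t. n \<bullet> moment t - k = (t - a) * (t - b) * (t - c)"
proof (intro exI allI)
  show "vector [a * b + a * c + b * c, - (a + b + c), 1] \<bullet> moment t - a * b * c = (t - a) * (t - b) * (t - c)" for t
    by (simp add: moment_def inner_vec_def sum_3 power2_eq_square power3_eq_cube algebra_simps)
qed

lemma plane_through_two_roots:
  "\<exists>(n :: real^3) k. \<forall>t. n \<bullet> moment t - k = (t - a) * (t - b)"
proof (intro exI allI)
  show "vector [- (a + b), 1, 0] \<bullet> moment t - (- a * b) = (t - a) * (t - b)" for t
    by (simp add: moment_def inner_vec_def sum_3 power2_eq_square power3_eq_cube algebra_simps)
qed

lemma segment_in_hyperplane:
  fixes n :: "'a::real_inner"
  assumes "n \<bullet> p = k" "n \<bullet> q = k" "x \<in> closed_segment p q"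
  shows "n \<bullet> x = k"
proof -
  have "closed_segment p q \<subseteq> {x. n \<bullet> x = k}"
    using assms(1,2) convex_hyperplane[of n k] by (intro closed_segment_subset) auto
  then show ?thesis using assms(3) by auto
qed

text \<open>The combinatorial form of piercing on the moment curve: on the parameter line, the three vertices
  of the triangle and the two ends of the edge alternate.\<close>

definition pierces :: "'a::linorder \<Rightarrow> 'a \<Rightarrow> 'a \<Rightarrow> 'a \<Rightarrow> 'a \<Rightarrow> bool" where
  "pierces u v w x y \<longleftrightarrow>
     (u < min x y \<or> v < min x y \<or> w < min x y) \<and>
     (min x y < u \<and> u < max x y \<or> min x y < v \<and> v < max x y \<or> min x y < w \<and> w < max x y) \<and>
     (max x y < u \<or> max x y < v \<or> max x y < w)"

text \<open>If one of the three parameter intervals cut out by \<open>l\<close> and \<open>h\<close> contains no vertex of the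
  triangle, there is a cubic that vanishes at \<open>l\<close> and \<open>h\<close> and has the same strict sign on the other two
  intervals: the sign pattern is arranged by doubling the root at \<open>l\<close> or at \<open>h\<close>, or neither. Its plane
  contains the edge and has the triangle strictly on one side.\<close>

lemma not_pierces_imp_disjoint:
  assumes nope: "\<not> pierces u v w x y" and off: "{x, y} \<inter> {u, v, w} = {}"
  shows "closed_segment (moment x) (moment y) \<inter> convex hull {moment u, moment v, moment w} = {}"
proof -
  define l h where "l = min x y" and "h = max x y"
  have lh: "l \<le> h" "x = l \<and> y = h \<or> x = h \<and> y = l"
    by (auto simp: l_def h_def)
  have separated: ?thesis
    if f: "\<And>t. n \<bullet> moment t - k = f t" "f x = 0" "f y = 0" and pos: "\<forall>t\<in>{u, v, w}. 0 < f t" for n k f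
  proof -
    have "convex hull {moment u, moment v, moment w} \<subseteq> {p. n \<bullet> p > k}"
      using pos convex_halfspace_gt[of k n] by (intro hull_minimal) (auto simp: f(1)[symmetric])
    moreover have "n \<bullet> p = k" if "p \<in> closed_segment (moment x) (moment y)" for p
      using segment_in_hyperplane[OF _ _ that, of n k] f(1)[of x] f(1)[of y] f(2,3) by simp
    ultimately show ?thesis by force
  qed
  have off': "\<forall>t\<in>{u, v, w}. t \<noteq> l \<and> t \<noteq> h"
    using off lh(2) by auto
  have "(\<forall>t\<in>{u, v, w}. \<not> t < l) \<or> (\<forall>t\<in>{u, v, w}. \<not> (l < t \<and> t < h)) \<or> (\<forall>t\<in>{u, v, w}. \<not> h < t)"
    using nope unfolding pierces_def l_def[symmetric] h_def[symmetric] by blast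
  then consider (none_below) "\<forall>t\<in>{u, v, w}. l < t" | (none_between) "\<forall>t\<in>{u, v, w}. t < l \<or> h < t"
    | (none_above) "\<forall>t\<in>{u, v, w}. t < h"
    using off' by (meson linorder_neqE)
  then show ?thesis
  proof cases
    case none_below
    obtain n k where nk: "\<And>t. n \<bullet> moment t - k = (t - l) * (t - h) * (t - h)"
      using plane_through_roots[of l h h] by blast
    show ?thesis
    proof (rule separated[OF nk])
      show "\<forall>t\<in>{u, v, w}. 0 < (t - l) * (t - h) * (t - h)"
        using none_below off' by (auto simp: mult.assoc zero_less_mult_iff neq_iff)
    qed (use lh in auto)
  next
    case none_between
    obtain n k where nk: "\<And>t. n \<bullet> moment t - k = (t - l) * (t - h)"
      using plane_through_two_roots[of l h] by blast
    show ?thesis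
    proof (rule separated[OF nk])
      show "\<forall>t\<in>{u, v, w}. 0 < (t - l) * (t - h)"
        using none_between lh(1) by (auto simp: zero_less_mult_iff)
    qed (use lh in auto)
  next
    case none_above
    obtain n k where nk: "\<And>t. n \<bullet> moment t - k = (t - l) * (t - l) * (t - h)"
      using plane_through_roots[of l l h] by blast
    have nk': "(- n) \<bullet> moment t - (- k) = (t - l) * (t - l) * (h - t)" for t
      using nk[of t] by (simp add: algebra_simps)
    show ?thesis
    proof (rule separated[OF nk'])
      show "\<forall>t\<in>{u, v, w}. 0 < (t - l) * (t - l) * (h - t)"
        using none_above off' by (auto simp: zero_less_mult_iff neq_iff)
    qed (use lh in auto)
  qed
qed

lemma moment_in_segment_iff:
  "moment t \<in> closed_segment (moment x) (moment y) \<longleftrightarrow> t = x \<or> t = y"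
proof
  obtain n k where nk: "\<And>t. n \<bullet> moment t - k = (t - x) * (t - y)"
    using plane_through_two_roots[of x y] by blast
  assume "moment t \<in> closed_segment (moment x) (moment y)"
  moreover have "n \<bullet> moment x = k" "n \<bullet> moment y = k"
    using nk[of x] nk[of y] by simp_all
  ultimately have "n \<bullet> moment t = k"
    using segment_in_hyperplane by blast
  then show "t = x \<or> t = y"
    using nk[of t] by auto
qed auto

lemma inj_moment: "inj moment"
proof (rule injI)
  fix s t assume "moment s = moment t"
  then have "moment s $ 1 = moment t $ 1"
    by simp
  then show "s = t"
    by (simp add: moment_def)
qed

lemma segments_at_common_vertex:
  assumes "y \<noteq> x" "z \<notin> {x, y}"
  shows "closed_segment (moment x) (moment y) \<inter> closed_segment (moment x) (moment z) = {moment x}"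
proof -
  obtain n k where nk: "\<And>t. n \<bullet> moment t - k = (t - x) * (t - y)"
    using plane_through_two_roots[of x y] by blast
  have "p = moment x" if p: "p \<in> closed_segment (moment x) (moment y)" "p \<in> closed_segment (moment x) (moment z)" for p
  proof -
    have x: "n \<bullet> moment x = k" and y: "n \<bullet> moment y = k" and z: "n \<bullet> moment z \<noteq> k"
      using nk[of x] nk[of y] nk[of z] assms by auto
    have 1: "n \<bullet> p = k"
      using x y p(1) by (rule segment_in_hyperplane)
    obtain s where s: "p = (1 - s) *\<^sub>R moment x + s *\<^sub>R moment z"
      using p(2) unfolding closed_segment_def by auto
    have "n \<bullet> p = k + s * (n \<bullet> moment z - k)"
      using x by (simp add: s inner_add_right algebra_simps)
    then have "s = 0"
      using 1 z by simp
    then show ?thesis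
      by (simp add: s)
  qed
  then show ?thesis by auto
qed

lemma segments_disjoint:
  assumes "distinct [x, y, z, w]"
  shows "closed_segment (moment x) (moment y) \<inter> closed_segment (moment z) (moment w) = {}"
proof -
  obtain n k where nk: "\<And>t. n \<bullet> moment t - k = (t - x) * (t - y) * (t - z)"
    using plane_through_roots[of x y z] by blast
  have False if p: "p \<in> closed_segment (moment x) (moment y)" "p \<in> closed_segment (moment z) (moment w)" for p
  proof -
    have x: "n \<bullet> moment x = k" and y: "n \<bullet> moment y = k"
      and z: "n \<bullet> moment z = k" and w: "n \<bullet> moment w \<noteq> k"
      using nk[of x] nk[of y] nk[of z] nk[of w] assms by auto
    have 1: "n \<bullet> p = k"
      using x y p(1) by (rule segment_in_hyperplane)
    obtain s where s: "p = (1 - s) *\<^sub>R moment z + s *\<^sub>R moment w"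
      using p(2) unfolding closed_segment_def by auto
    have "n \<bullet> p = k + s * (n \<bullet> moment w - k)"
      using z by (simp add: s inner_add_right algebra_simps)
    then have "s = 0"
      using 1 w by simp
    then have "moment z \<in> closed_segment (moment x) (moment y)"
      using p(1) s by simp
    then show False
      using assms by (simp add: moment_in_segment_iff)
  qed
  then show ?thesis by auto
qed

lemma triangle_moment_replace:
  assumes "distinct [a, b, c, d]"
  shows "ambient_isotopic (triangle_boundary (moment a) (moment b) (moment c))
           (triangle_boundary (moment a) (moment d) (moment c))"
  using assms by (intro triangle_replace_vertex vol_moment_nonzero)

text \<open>The vertices are replaced one at a time, first by the parameters \<open>-1\<close>, \<open>-2\<close>, \<open>-3\<close>, which are
  certainly different from the given ones, and then by the vertices of the standard triangle. Only
  the last replacements need numerical checks of general position.\<close>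

lemma triangle_moment_unknotted:
  assumes "distinct [a, b, c]" "0 \<le> a" "0 \<le> b" "0 \<le> c"
  shows "ambient_isotopic (triangle_boundary (moment a) (moment b) (moment c)) standard_circle"
proof -
  let ?T = "\<lambda>a b c. triangle_boundary a b c"
  let ?m = moment
  let ?e\<^sub>1 = "vector [1, 0, 0] :: real^3" and ?e\<^sub>2 = "vector [0, 1, 0] :: real^3" and ?e\<^sub>3 = "vector [-1, -1, 0] :: real^3"
  note [trans] = ambient_isotopic_trans and rot = triangle_boundary_rotate
  have "ambient_isotopic (?T (?m a) (?m b) (?m c)) (?T (?m a) (?m (-1)) (?m c))"
    using assms by (intro triangle_moment_replace) auto
  also have "\<dots> = ?T (?m (-1)) (?m c) (?m a)"
    by (rule rot[symmetric])
  also have "ambient_isotopic \<dots> (?T (?m (-1)) (?m (-2)) (?m a))"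
    using assms by (intro triangle_moment_replace) auto
  also have "\<dots> = ?T (?m (-2)) (?m a) (?m (-1))"
    by (rule rot[symmetric])
  also have "ambient_isotopic \<dots> (?T (?m (-2)) (?m (-3)) (?m (-1)))"
    using assms by (intro triangle_moment_replace) auto
  also have "ambient_isotopic \<dots> (?T (?m (-2)) ?e\<^sub>1 (?m (-1)))"
    by (rule triangle_replace_vertex) (simp add: vol_def moment_def cross3_simps)
  also have "\<dots> = ?T ?e\<^sub>1 (?m (-1)) (?m (-2))"
    by (rule rot[symmetric])
  also have "ambient_isotopic \<dots> (?T ?e\<^sub>1 ?e\<^sub>2 (?m (-2)))"
    by (rule triangle_replace_vertex) (simp add: vol_def moment_def cross3_simps)
  also have "\<dots> = ?T ?e\<^sub>2 (?m (-2)) ?e\<^sub>1"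
    by (rule rot[symmetric])
  also have "ambient_isotopic \<dots> (?T ?e\<^sub>2 ?e\<^sub>3 ?e\<^sub>1)"
    by (rule triangle_replace_vertex) (simp add: vol_def moment_def cross3_simps)
  also have "\<dots> = ?T ?e\<^sub>1 ?e\<^sub>2 ?e\<^sub>3"
    by (rule rot)
  also have "ambient_isotopic \<dots> standard_circle"
    by (rule standard_triangle_isotopic_circle)
  finally show ?thesis .
qed

section \<open>Polygons on the moment curve\<close>

definition polygon :: "nat list \<Rightarrow> (real^3) set" where
  "polygon ts = (\<Union>(a, b)\<in>set (zip ts (rotate1 ts)). closed_segment (moment (real a)) (moment (real b)))"

lemma zip_rotate1: "length xs = length ys \<Longrightarrow> zip (rotate1 xs) (rotate1 ys) = rotate1 (zip xs ys)"
  by (cases xs; cases ys) auto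

lemma zip_rotate: "length xs = length ys \<Longrightarrow> zip (rotate n xs) (rotate n ys) = rotate n (zip xs ys)"
  by (induction n) (simp_all add: zip_rotate1)

lemma polygon_rotate1: "polygon (rotate1 ts) = polygon ts"
  by (simp add: polygon_def zip_rotate1)

lemma polygon_rotate: "polygon (rotate n ts) = polygon ts"
  by (induction n) (simp_all add: polygon_rotate1)

lemma pierces_of_nat:
  "pierces (real u) (real v) (real w) (real a) (real b) \<longleftrightarrow> pierces u v w a b"
  unfolding pierces_def of_nat_min[symmetric] of_nat_max[symmetric] of_nat_less_iff by (rule refl)

text \<open>Four distinct points of the moment curve are never coplanar, so the two edges that share a vertex
  with the triangle are automatically transversal to it; only the remaining edges need the test.\<close>

lemma polygon_drop_vertex:
  assumes dist: "distinct (u # v # w # x # r)"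
    and free: "\<forall>(a, b)\<in>set (zip (w # x # r) (x # r @ [u])). \<not> pierces u v w a b"
  shows "ambient_isotopic (polygon (u # v # w # x # r)) (polygon (u # w # x # r))"
proof -
  let ?m = "\<lambda>n :: nat. moment (real n)"
  let ?E = "set (zip (w # x # r) (x # r @ [u]))"
  let ?\<S> = "(\<lambda>(a, b). closed_segment (?m a) (?m b)) ` ?E"
  have off_plane: "?m y \<notin> affine hull {?m u, ?m v, ?m w}" if "y \<notin> {u, v, w}" for y
    using that dist vol_moment_nonzero[of u v w y] affine_hull_imp_vol_0 by auto
  have "\<not> collinear {?m u, ?m v, ?m w}"
    using dist vol_moment_nonzero[of u v w x] collinear_imp_vol_0 by auto
  moreover have "compact S \<and> S \<inter> convex hull {?m u, ?m v, ?m w} = {} \<or>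
      (\<exists>a\<in>{?m u, ?m w}. \<exists>y. y \<notin> affine hull {?m u, ?m v, ?m w} \<and> S = closed_segment a y)"
    if S_in: "S \<in> ?\<S>" for S
  proof -
    obtain e where e: "S = (case e of (a, b) \<Rightarrow> closed_segment (?m a) (?m b))" "e \<in> ?E"
      using S_in by (rule imageE)
    obtain a b where "e = (a, b)"
      by (cases e)
    then have ab: "(a, b) \<in> ?E" and S: "S = closed_segment (?m a) (?m b)"
      using e by (simp_all only: prod.case)
    have "a = w \<and> b = x \<or> a \<in> set (x # r) \<and> b \<in> set (r @ [u])"
      using ab set_zip_leftD[of a b "x # r" "r @ [u]"] set_zip_rightD[of a b "x # r" "r @ [u]"] by auto
    then consider "a = w" "b \<notin> {u, v, w}" | "a \<notin> {u, v, w}" "b = u" | "a \<notin> {u, v, w}" "b \<notin> {u, v, w}"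
      using dist by auto
    then show ?thesis
    proof cases
      case 1
      then show ?thesis using off_plane S by blast
    next
      case 2
      then show ?thesis using off_plane S by (metis closed_segment_commute insertI1)
    next
      case 3
      have "\<not> pierces (real u) (real v) (real w) (real a) (real b)"
        using bspec[OF free ab] by (simp only: pierces_of_nat prod.case not_False_eq_True)
      then have "S \<inter> convex hull {?m u, ?m v, ?m w} = {}"
        unfolding S using 3 by (intro not_pierces_imp_disjoint) auto
      then show ?thesis
        by (simp add: S)
    qed
  qed
  ultimately have "ambient_isotopic (closed_segment (?m u) (?m v) \<union> closed_segment (?m v) (?m w) \<union> \<Union>?\<S>)
      (closed_segment (?m u) (?m w) \<union> \<Union>?\<S>)"
    by (intro triangle_move) auto
  moreover have "polygon (u # v # w # x # r) = closed_segment (?m u) (?m v) \<union> closed_segment (?m v) (?m w) \<union> \<Union>?\<S>"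
    "polygon (u # w # x # r) = closed_segment (?m u) (?m w) \<union> \<Union>?\<S>"
    by (simp_all add: polygon_def Un_assoc)
  ultimately show ?thesis
    by simp
qed

text \<open>The following tests are meant for evaluation by rewriting: the conditionals keep branches that are
  not taken from being unfolded.\<close>

fun unpierced :: "nat \<Rightarrow> nat \<Rightarrow> nat \<Rightarrow> nat list \<Rightarrow> bool" where
  "unpierced u v w (a # b # r) = (if pierces u v w a b then False else unpierced u v w (b # r))"
| "unpierced u v w _ = True"

lemma unpierced_iff:
  "unpierced u v w (h # t @ [z]) \<longleftrightarrow> (\<forall>(a, b)\<in>set (zip (h # t) (t @ [z])). \<not> pierces u v w a b)"
proof (induction t arbitrary: h)
  case (Cons x t)
  show ?case
    using Cons.IH[of x] by simp
qed simp

text \<open>The second vertex of the list is dropped if that is a legal triangle move; otherwise the list is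
  rotated. The first argument bounds the number of steps.\<close>

fun shrinks :: "nat \<Rightarrow> nat list \<Rightarrow> bool" where
  "shrinks k [a, b, c] = True"
| "shrinks (Suc k) (u # v # w # x # r) =
    (if unpierced u v w (w # x # r @ [u]) then shrinks k (u # w # x # r) else shrinks k (v # w # x # r @ [u]))"
| "shrinks _ _ = False"

lemma shrinks_imp_unknotted:
  "shrinks k ts \<Longrightarrow> distinct ts \<Longrightarrow> ambient_isotopic (polygon ts) standard_circle"
proof (induction k ts rule: shrinks.induct)
  case (1 k a b c)
  then show ?case
    using triangle_moment_unknotted[of a b c]
    by (simp add: polygon_def triangle_boundary_def Un_assoc)
next
  case (2 k u v w x r)
  show ?case
  proof (cases "unpierced u v w (w # x # r @ [u])")
    case True
    then have "ambient_isotopic (polygon (u # v # w # x # r)) (polygon (u # w # x # r))"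
      using 2(4) unpierced_iff[of u v w w "x # r" u] by (intro polygon_drop_vertex) simp_all
    moreover have "ambient_isotopic (polygon (u # w # x # r)) standard_circle"
      using 2(3,4) True by (intro 2(1)) simp_all
    ultimately show ?thesis
      by (rule ambient_isotopic_trans)
  next
    case False
    then have "ambient_isotopic (polygon (rotate1 (u # v # w # x # r))) standard_circle"
      using 2(2)[OF False] 2(3,4) by simp
    then show ?thesis
      by (simp only: polygon_rotate1)
  qed
qed simp_all

text \<open>Depth-first search through the paths that start at the vertex \<open>s\<close> and use only larger vertices
  otherwise; \<open>p\<close> is the reversed path so far and the last argument lists the candidates for the next
  vertex. Whenever the path can be closed up at \<open>s\<close>, the resulting cycle has to shrink. Up to rotation
  every cycle is met, with its smallest vertex as \<open>s\<close>. Twelve steps are enough for the cycles below.\<close>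

fun visit :: "(nat \<Rightarrow> nat list) \<Rightarrow> nat \<Rightarrow> nat \<Rightarrow> nat list \<Rightarrow> nat list \<Rightarrow> bool" where
  "visit nb k s p [] = True"
| "visit nb 0 s p (b # bs) = False"
| "visit nb (Suc k) s p (b # bs) =
    (if (if b = s then if length p < 3 then True else shrinks 12 p
         else if b < s then True
         else if b \<in> set p then True
         else visit nb k s (b # p) (nb b))
     then visit nb (Suc k) s p bs else False)"

lemma visit_close: "visit nb k s p bs \<Longrightarrow> s \<in> set bs \<Longrightarrow> 3 \<le> length p \<Longrightarrow> shrinks 12 p"
  by (induction nb k s p bs rule: visit.induct) (auto split: if_splits)

lemma visit_extend:
  "visit nb k s p bs \<Longrightarrow> b \<in> set bs \<Longrightarrow> s < b \<Longrightarrow> b \<notin> set p \<Longrightarrow> \<exists>k'. visit nb k' s (b # p) (nb b)"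
proof (induction bs)
  case (Cons c bs)
  obtain k' where "k = Suc k'"
    using Cons.prems(1) by (cases k) auto
  then show ?case
    using Cons by (cases "b = c") (auto split: if_splits)
qed simp

lemma visit_imp_shrinks:
  assumes "visit nb k s p (nb (hd p))" "p \<noteq> []" "distinct (q @ p)" "\<forall>b\<in>set q. s < b"
    "successively (\<lambda>a b. a \<in> set (nb b)) (q @ [hd p])"
    "s \<in> set (nb (hd (q @ p)))" "3 \<le> length (q @ p)"
  shows "shrinks 12 (q @ p)"
  using assms
proof (induction q arbitrary: k p rule: rev_induct)
  case Nil
  then show ?case
    using visit_close by simp
next
  case (snoc b q)
  have b: "b \<in> set (nb (hd p))"
    using snoc.prems(5) by (simp add: successively_append_iff)
  obtain k' where "visit nb k' s (b # p) (nb b)"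
    using visit_extend[OF snoc.prems(1) b] snoc.prems(3,4) by auto
  then have "shrinks 12 (q @ b # p)"
    using snoc.prems by (intro snoc.IH) (simp_all add: successively_append_iff)
  then show ?case by simp
qed

lemma zip_imp_successively:
  "\<forall>(a, b)\<in>set (zip (h # t) (t @ [z])). P a b \<Longrightarrow> successively P (h # t @ [z])"
  by (induction t arbitrary: h) auto

lemma cycle_unknotted:
  assumes all: "\<And>s. s \<in> set ts \<Longrightarrow> visit nb k s [s] (nb s)"
    and ts: "distinct ts" "3 \<le> length ts"
    and adj: "\<forall>(a, b)\<in>set (zip ts (rotate1 ts)). a \<in> set (nb b) \<and> b \<in> set (nb a)"
  shows "ambient_isotopic (polygon ts) standard_circle"
proof -
  let ?P = "\<lambda>a b. a \<in> set (nb b) \<and> b \<in> set (nb a)"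
  \<comment> \<open>The cycle is rotated so that its smallest vertex, where the search starts, comes last.\<close>
  define s where "s = Min (set ts)"
  have "ts \<noteq> []"
    using ts(2) by auto
  then have s: "s \<in> set ts" "\<And>b. b \<in> set ts \<Longrightarrow> s \<le> b"
    by (simp_all add: s_def)
  obtain xs ys where split: "ts = xs @ s # ys"
    using split_list[OF s(1)] by blast
  define q where "q = ys @ xs"
  have rot: "rotate (Suc (length xs)) ts = q @ [s]"
    by (simp add: split q_def rotate_append)
  have "q @ [s] \<noteq> []"
    by simp
  then obtain h t where ht: "q @ [s] = h # t"
    by (cases "q @ [s]") blast+
  have "set (zip (q @ [s]) (rotate1 (q @ [s]))) = set (zip ts (rotate1 ts))"
    unfolding rot[symmetric] rotate1_rotate_swap by (simp add: zip_rotate del: rotate_Suc)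
  then have "\<forall>(a, b)\<in>set (zip (h # t) (t @ [h])). ?P a b"
    using adj by (simp add: ht)
  then have "successively ?P ((h # t) @ [h])"
    using zip_imp_successively[of h t h ?P] by simp
  then have "successively ?P ((q @ [s]) @ [h])"
    by (simp only: ht)
  then have succ: "successively ?P (q @ [s])" and close: "?P s h"
    by (simp_all add: successively_append_iff)
  have "shrinks 12 (q @ [s])"
  proof (rule visit_imp_shrinks)
    show "visit nb k s [s] (nb (hd [s]))"
      using all[OF s(1)] by simp
    show d: "distinct (q @ [s])"
      using ts(1) by (auto simp: split q_def)
    have "set (q @ [s]) = set ts"
      by (auto simp: split q_def)
    then show "\<forall>b\<in>set q. s < b"
      using s(2) d by (metis Un_iff distinct_append disjoint_iff list.set_intros(1) order_le_less set_append)
    show "successively (\<lambda>a b. a \<in> set (nb b)) (q @ [hd [s]])"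
      using succ by (auto elim: successively_mono)
    show "s \<in> set (nb (hd (q @ [s])))"
      using close ht by simp
    show "3 \<le> length (q @ [s])"
      using ts(2) by (simp add: split q_def)
  qed simp
  moreover have "distinct (q @ [s])"
    using ts(1) by (auto simp: split q_def)
  ultimately have "ambient_isotopic (polygon (q @ [s])) standard_circle"
    by (rule shrinks_imp_unknotted)
  then show ?thesis
    by (simp only: polygon_rotate flip: rot)
qed

section \<open>Straight graphs on the moment curve\<close>

text \<open>Since no four points of the moment curve are coplanar, straight edges between them meet only in
  common end points. \<open>Min\<close> and \<open>Max\<close> merely select a direction in which to run along an edge.\<close>

lemma moment_spatial_embedding:
  assumes G: "simple_graph G" and inj: "inj_on pos (verts G)"
  shows "spatial_embedding G (\<lambda>v. moment (pos v)) (\<lambda>e. linepath (moment (Min (pos ` e))) (moment (Max (pos ` e))))"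
    (is "spatial_embedding G ?p ?\<gamma>")
proof -
  have edge: "\<exists>a b. e = {a, b} \<and> pos a \<noteq> pos b \<and> a \<in> verts G \<and> b \<in> verts G" if "e \<in> edges G" for e
    using G inj that unfolding simple_graph_def card_2_iff
    by (metis inj_onD insert_subset)
  have ends: "{pathstart (?\<gamma> {a, b}), pathfinish (?\<gamma> {a, b})} = {?p a, ?p b}" for a b
    by (auto simp: min_def max_def)
  have image: "path_image (?\<gamma> {a, b}) = closed_segment (?p a) (?p b)" for a b
    by (auto simp: min_def max_def closed_segment_commute)
  show ?thesis
    unfolding spatial_embedding_def
  proof (intro conjI ballI impI)
    show "inj_on ?p (verts G)"
      using inj inj_moment by (auto simp: inj_on_def)
    fix e assume "e \<in> edges G"
    then obtain a b where e: "e = {a, b}" and ab: "pos a \<noteq> pos b" "a \<in> verts G" "b \<in> verts G"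
      using edge by blast
    show "arc (?\<gamma> e)"
      using ab by (auto simp: e min_def max_def inj_eq[OF inj_moment] intro!: arc_linepath)
    show "{pathstart (?\<gamma> e), pathfinish (?\<gamma> e)} = ?p ` e"
      unfolding e ends by simp
    show "path_image (?\<gamma> e) \<inter> ?p ` verts G = ?p ` e"
      unfolding e image using ab inj by (auto simp: moment_in_segment_iff dest: inj_onD)
    fix e' assume "e' \<in> edges G" "e \<noteq> e'"
    then obtain c d where e': "e' = {c, d}" and cd: "pos c \<noteq> pos d" "c \<in> verts G" "d \<in> verts G"
      using edge by blast
    have common: "path_image (?\<gamma> e) \<inter> path_image (?\<gamma> e') = ?p ` (e \<inter> e')"
      if xyz: "e = {x, y}" "e' = {x, z}" "pos y \<noteq> pos x" "pos z \<noteq> pos x" "y \<noteq> z" "y \<in> verts G" "z \<in> verts G"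
      for x y z
    proof -
      have "pos z \<noteq> pos y"
        using xyz inj by (metis inj_onD)
      moreover have "e \<inter> e' = {x}"
        using xyz by auto
      ultimately show ?thesis
        unfolding \<open>e \<inter> e' = {x}\<close> unfolding xyz(1,2) image using xyz by (simp add: segments_at_common_vertex)
    qed
    show "path_image (?\<gamma> e) \<inter> path_image (?\<gamma> e') = ?p ` (e \<inter> e')"
    proof (cases "{a, b} \<inter> {c, d} = {}")
      case True
      then have "distinct [pos a, pos b, pos c, pos d]"
        using ab cd inj by (auto dest: inj_onD)
      then show ?thesis
        unfolding e e' image True using segments_disjoint by simp
    next
      case False
      then consider "a = c" "b \<noteq> d" | "a = d" "b \<noteq> c" | "b = c" "a \<noteq> d" | "b = d" "a \<noteq> c"
        using \<open>e \<noteq> e'\<close> unfolding e e' by auto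
      then show ?thesis
      proof cases
        case 1
        then show ?thesis using ab cd by (intro common[of a b d]) (auto simp: e e')
      next
        case 2
        then show ?thesis using ab cd by (intro common[of a b c]) (auto simp: e e')
      next
        case 3
        then show ?thesis using ab cd by (intro common[of b a d]) (auto simp: e e')
      next
        case 4
        then show ?thesis using ab cd by (intro common[of b a c]) (auto simp: e e')
      qed
    qed
  qed
qed

lemma cycle_image_moment:
  fixes pos :: "'v \<Rightarrow> nat"
  shows "cycle_image (\<lambda>e. linepath (moment (Min ((\<lambda>v. real (pos v)) ` e))) (moment (Max ((\<lambda>v. real (pos v)) ` e)))) vs
    = polygon (map pos vs)"
proof -
  have sides: "closed_segment (moment (min x y)) (moment (max x y)) = closed_segment (moment x) (moment y)" for x y
    by (auto simp: min_def max_def closed_segment_commute)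
  show ?thesis
    unfolding cycle_image_def cycle_edges_def polygon_def rotate1_map zip_map_map set_map
    by (simp add: case_prod_beta sides)
qed

lemma not_intrinsically_knottedI:
  fixes pos :: "'v \<Rightarrow> nat"
  assumes G: "simple_graph G" and inj: "inj_on pos (verts G)"
    and nb: "\<And>a b. {a, b} \<in> edges G \<Longrightarrow> pos b \<in> set (nb (pos a))"
    and visit: "\<And>v. v \<in> verts G \<Longrightarrow> visit nb k (pos v) [pos v] (nb (pos v))"
  shows "\<not> intrinsically_knotted G"
proof -
  define \<gamma> where "\<gamma> e = linepath (moment (Min ((\<lambda>v. real (pos v)) ` e))) (moment (Max ((\<lambda>v. real (pos v)) ` e)))" for e
  have "inj_on (\<lambda>v. real (pos v)) (verts G)"
    using inj by (simp add: inj_on_def)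
  then have "spatial_embedding G (\<lambda>v. moment (real (pos v))) \<gamma>"
    unfolding \<gamma>_def by (rule moment_spatial_embedding[OF G])
  moreover have "ambient_isotopic (cycle_image \<gamma> vs) standard_circle" if vs: "is_cycle G vs" for vs
  proof -
    have "ambient_isotopic (polygon (map pos vs)) standard_circle"
    proof (rule cycle_unknotted)
      show "visit nb k s [s] (nb s)" if "s \<in> set (map pos vs)" for s
        using that visit vs unfolding is_cycle_def by auto
      show "distinct (map pos vs)" "3 \<le> length (map pos vs)"
        using vs inj unfolding is_cycle_def by (auto simp: distinct_map inj_on_subset)
      have "pos a \<in> set (nb (pos b)) \<and> pos b \<in> set (nb (pos a))" if "(a, b) \<in> set (zip vs (rotate1 vs))" for a b
      proof -
        have "{a, b} \<in> edges G"
          using vs that unfolding is_cycle_def cycle_edges_def by force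
        then show ?thesis
          using nb[of a b] nb[of b a] by (simp add: insert_commute)
      qed
      then show "\<forall>(a, b)\<in>set (zip (map pos vs) (rotate1 (map pos vs))). a \<in> set (nb b) \<and> b \<in> set (nb a)"
        unfolding rotate1_map zip_map_map set_map by auto
    qed
    then show ?thesis
      unfolding \<gamma>_def cycle_image_moment .
  qed
  ultimately show ?thesis
    unfolding intrinsically_knotted_def nontrivial_knot_def by blast
qed

section \<open>An arrangement without knotted cycles\<close>

text \<open>The order along the moment curve matters: it is chosen so that the greedy reduction succeeds for
  every cycle. The vertices \<open>Va\<close> and \<open>Vb\<close> were deleted by the last two moves; their values are
  arbitrary.\<close>

primrec position :: "vertex \<Rightarrow> nat" where
  "position Va = 10" | "position Vb = 11" | "position Vc = 0" | "position Vd = 1"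
| "position Ve = 4" | "position Vf = 7" | "position Vg = 6" | "position Vh = 9"
| "position Vi = 3" | "position Vj = 8" | "position Vk = 2" | "position Vl = 5"

definition adjacency :: "nat \<Rightarrow> nat list" where
  "adjacency n = [[1, 4, 6, 7, 9], [0, 2, 3, 6], [1, 5, 7, 9], [1, 4, 8, 9], [0, 3, 5, 7],
     [2, 4, 6, 9], [0, 1, 5, 8], [0, 2, 4, 8], [3, 6, 7, 9], [0, 2, 3, 5, 8]] ! n"

lemma adjacency_position:
  assumes "{a, b} \<in> edges G7_explicit"
  shows "position b \<in> set (adjacency (position a))"
  using assms by (auto simp: G7_explicit_def adjacency_def doubleton_eq_iff)

lemma visit_G7: "s < 10 \<Longrightarrow> visit adjacency 11 s [s] (adjacency s)"
proof -
  have "visit adjacency 11 0 [0] (adjacency 0)" "visit adjacency 11 1 [1] (adjacency 1)"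
    "visit adjacency 11 2 [2] (adjacency 2)" "visit adjacency 11 3 [3] (adjacency 3)"
    "visit adjacency 11 4 [4] (adjacency 4)" "visit adjacency 11 5 [5] (adjacency 5)"
    "visit adjacency 11 6 [6] (adjacency 6)" "visit adjacency 11 7 [7] (adjacency 7)"
    "visit adjacency 11 8 [8] (adjacency 8)" "visit adjacency 11 9 [9] (adjacency 9)"
    by code_simp+
  moreover assume "s < 10"
  then have "s \<in> {0, 1, 2, 3, 4, 5, 6, 7, 8, 9}"
    by auto
  ultimately show ?thesis
    by blast
qed

lemma G7_explicit_not_intrinsically_knotted: "\<not> intrinsically_knotted G7_explicit"
proof (rule not_intrinsically_knottedI)
  show "simple_graph G7_explicit"
    by (rule simple_graph_G7_explicit)
  show "inj_on position (verts G7_explicit)"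
    by (simp add: G7_explicit_def)
  show "visit adjacency 11 (position v) [position v] (adjacency (position v))" if "v \<in> verts G7_explicit" for v
    using that by (intro visit_G7) (auto simp: G7_explicit_def)
qed (rule adjacency_position)

theorem mainTheorem2:
  fixes G\<^sub>1 G\<^sub>2 G\<^sub>3 G\<^sub>4 G\<^sub>5 G\<^sub>6 G\<^sub>7 :: "vertex ugraph"
  assumes "nablaY_move K7 Va Vb Vc Vh G\<^sub>1"
    and "nablaY_move G\<^sub>1 Va Vd Ve Vi G\<^sub>2"
    and "nablaY_move G\<^sub>2 Va Vf Vg Vj G\<^sub>3"
    and "nablaY_move G\<^sub>3 Vb Vd Vf Vk G\<^sub>4"
    and "nablaY_move G\<^sub>4 Vb Ve Vg Vl G\<^sub>5"
    and "Ynabla_move G\<^sub>5 Va Vh Vi Vj G\<^sub>6"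
    and "Ynabla_move G\<^sub>6 Vb Vh Vk Vl G\<^sub>7"
  shows "\<not> intrinsically_knotted G\<^sub>7"
proof -
  have "G\<^sub>7 = G7_explicit"
    using assms moves_iff_G7_explicit by blast
  then show ?thesis
    using G7_explicit_not_intrinsically_knotted by simp
qed

end
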